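(* Let $V$ be an $\mathbb{N}$-graded vertex algebra and $M$ a module for Zhu's algebra $A(V)$. Then $(S(M),Y_{S(M)})$, graded by degree, is an $\mathbb{N}$-gradable weak $V$-module.
   Context: An $\mathbb{N}$-graded vertex algebra is a vertex algebra $(V,Y,\mathbf{1})$ with $V=\coprod_{n\in\mathbb{Z}}V_{(n)}$, $V_{(n)}=0$ for $n<0$, and $[d,Y(u,x)]=x\frac{d}{dx}Y(u,x)+Y(du,x)$ where $du=nu$ for $u\in V_{(n)}$; write $\mathrm{wt}\,u=n$ for $u\in V_{(n)}$, $Y(u,x)=\sum_nu_nx^{-n-1}$, and let $L(0)=d$, so $x^{L(0)}u=x^{\mathrm{wt}\,u}u$ for homogeneous $u$. An $\mathbb{N}$-gradable weak $V$-module is a module $W=\coprod_{n\in\mathbb{N}}W_{(n)}$ for the vertex algebra $V$ such that for $u\in V_{(m)}$, $u_n=\mathrm{Res}_xx^nY_W(u,x)$ maps $W_{(j)}$ to $W_{(j+m-n-1)}$. Zhu's algebra: $O(V)$ is the span of $\mathrm{Res}_xx^nY((x+1)^{L(0)}u,x)v$ for $u,v\in V$, $n\le-2$; $A(V)=V/O(V)$ with the associative product $u*v=\mathrm{Res}_xx^{-1}Y((x+1)^{L(0)}u,x)v$. Construction of $S(M)$: let $\rho:A(V)\to\mathrm{End}\,M$ be the representation. In $V[t,t^{-1}]=V\otimes\mathbb{C}[t,t^{-1}]$ write $u(m)=u\otimes t^m$; let $T(V[t,t^{-1}])$ be its tensor algebra and consider the left $T(V[t,t^{-1}])$-module $T(V[t,t^{-1}])\otimes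 M$, spanned by $u_1(m_1)\cdots u_r(m_r)w$ ($w\in M$), of degree $\sum_i(\mathrm{wt}\,u_i-m_i-1)$ for homogeneous $u_i$ (elements of $M$ have degree $0$). Put $Y_t(u,x)=\sum_mu(m)x^{-m-1}$ and $o_t(u)=u(\mathrm{wt}\,u-1)$ for homogeneous $u$. Let $\mathcal{I}$ be the $T(V[t,t^{-1}])$-submodule generated by: (1) $u(m)w$ for homogeneous $u\in V$ and homogeneous $w\in T(V[t,t^{-1}])\otimes M$ with $\mathrm{wt}\,u-m-1+\deg w<0$; (2) $o_t(u)w-\rho(u+O(V))w$ for $u\in V$, $w\in M$; (3) $u(p)v(q)w-\sum_{i=0}^{\mathrm{wt}\,v+\deg w-q-1}\sum_{j=0}^{\mathrm{wt}\,u+\deg w}\binom{p-\mathrm{wt}\,u-\deg w}{i}\binom{\mathrm{wt}\,u+\deg w}{j}(u_{p-\mathrm{wt}\,u-\deg w-i+j}v)(q+\mathrm{wt}\,u+\deg w+i-j)w$ for homogeneous $u,v\in V$, homogeneous $w\in T(V[t,t^{-1}])\otimes M$, $p,q\in\mathbb{Z}$ with $\mathrm{wt}\,v+\deg w>q$ and $\mathrm{wt}\,u-p-1+\mathrm{wt}\,v-q-1+\deg w\ge0$. Let $S_1(M)=(T(V[t,t^{-1}])\otimes M)/\mathcal{I}$ (a graded $T(V[t,t^{-1}])$-module) with $Y_{S_1(M)}(u,x)$ induced by $Y_t(u,x)$. Let $\mathcal{J}$ be the $T(V[t,t^{-1}])$-submodule of $S_1(M)$ generated by the elements $\mathrm{Res}_{x_0}\mathrm{Res}_{x_2}x_0^{p-\mathrm{wt}\,u-\deg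 w-i}x_2^{q+i}(x_0+x_2)^{\mathrm{wt}\,u+\deg w}Y_{S_1(M)}(Y(u,x_0)v,x_2)w$, i.e. $\sum_{j=0}^{\mathrm{wt}\,u+\deg w}\binom{\mathrm{wt}\,u+\deg w}{j}(u_{p-i-j}v)(q+i+j)w$, for homogeneous $u,v\in V$, homogeneous $w\in S_1(M)$, $p,q\in\mathbb{Z}$ and integers $i\ge\mathrm{wt}\,v+\deg w-q$. Finally $S(M)=S_1(M)/\mathcal{J}$ with $Y_{S(M)}(u,x)w=\sum_m(u(m)w)x^{-m-1}$ induced by $Y_t$. *)

theory Defs
  imports Complex_Main
begin

text \<open>A vertex algebra over the complex numbers: the vector space is given by the
  type 'v with scalar multiplication sV; Y u n v is the mode u_n v, i.e.
  Y(u,x) v = sum_n (Y u n v) x^(-n-1); vac is the vacuum.  The Jacobi identity is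
  stated coefficientwise (Borcherds identity); the sums are finite by truncation,
  which is expressed by requiring equality of all sufficiently long partial sums.\<close>

definition vertex_algebra ::
  "(complex \<Rightarrow> 'v::ab_group_add \<Rightarrow> 'v) \<Rightarrow> ('v \<Rightarrow> int \<Rightarrow> 'v \<Rightarrow> 'v) \<Rightarrow> 'v \<Rightarrow> bool" where
  "vertex_algebra sV Y vac \<longleftrightarrow>
     vector_space sV \<and>
     (\<forall>u n. Vector_Spaces.linear sV sV (Y u n)) \<and>
     (\<forall>n v. Vector_Spaces.linear sV sV (\<lambda>u. Y u n v)) \<and>
     (\<forall>u v. \<exists>N. \<forall>n\<ge>N. Y u n v = 0) \<and>
     (\<forall>n v. Y vac n v = (if n = -1 then v else 0)) \<and>
     (\<forall>u. (\<forall>n\<ge>0. Y u n vac = 0) \<and> Y u (-1) vac = u) \<and>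
     (\<forall>u v w p q r. \<exists>N::nat. \<forall>n\<ge>N.
        (\<Sum>i\<le>n. sV ((of_int p) gchoose i) (Y (Y u (r + int i) v) (p + q - int i) w)) =
        (\<Sum>i\<le>n. sV ((-1) ^ i * ((of_int r) gchoose i))
            (Y u (p + r - int i) (Y v (q + int i) w)
             - sV ((-1) powi r) (Y v (q + r - int i) (Y u (p + int i) w)))))"

definition is_decomp :: "(int \<Rightarrow> 'v::ab_group_add set) \<Rightarrow> 'v \<Rightarrow> (int \<Rightarrow> 'v) \<Rightarrow> bool" where
  "is_decomp Vg v c \<longleftrightarrow>
     finite {n. c n \<noteq> 0} \<and> (\<forall>n. c n \<in> Vg n) \<and> v = (\<Sum>n\<in>{n. c n \<noteq> 0}. c n)"

definition comp :: "(int \<Rightarrow> 'v::ab_group_add set) \<Rightarrow> 'v \<Rightarrow> int \<Rightarrow> 'v" where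
  "comp Vg v = (THE c. is_decomp Vg v c)"

text \<open>N-graded vertex algebra; L0 is the grading operator d (d u = n u on V_(n)),
  and the commutator formula [d, Y(u,x)] = x d/dx Y(u,x) + Y(du,x) is written in modes.\<close>

definition graded_vertex_algebra ::
  "(complex \<Rightarrow> 'v::ab_group_add \<Rightarrow> 'v) \<Rightarrow> ('v \<Rightarrow> int \<Rightarrow> 'v \<Rightarrow> 'v) \<Rightarrow> 'v
    \<Rightarrow> (int \<Rightarrow> 'v set) \<Rightarrow> ('v \<Rightarrow> 'v) \<Rightarrow> bool" where
  "graded_vertex_algebra sV Y vac Vg L0 \<longleftrightarrow>
     vertex_algebra sV Y vac \<and>
     (\<forall>n. module.subspace sV (Vg n)) \<and>
     (\<forall>v. \<exists>!c. is_decomp Vg v c) \<and>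
     (\<forall>n<0. Vg n = {0}) \<and>
     Vector_Spaces.linear sV sV L0 \<and>
     (\<forall>n u. u \<in> Vg n \<longrightarrow> L0 u = sV (of_int n) u) \<and>
     (\<forall>u n v. L0 (Y u n v) - Y u n (L0 v) = sV (of_int (- n - 1)) (Y u n v) + Y (L0 u) n v)"

text \<open>zhu_res n u v = Res_x x^n Y((x+1)^L(0) u, x) v, computed on homogeneous components.\<close>

definition zhu_res ::
  "(complex \<Rightarrow> 'v::ab_group_add \<Rightarrow> 'v) \<Rightarrow> ('v \<Rightarrow> int \<Rightarrow> 'v \<Rightarrow> 'v) \<Rightarrow> (int \<Rightarrow> 'v set)
    \<Rightarrow> int \<Rightarrow> 'v \<Rightarrow> 'v \<Rightarrow> 'v" where
  "zhu_res sV Y Vg n u v =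
     (\<Sum>k\<in>{k. comp Vg u k \<noteq> 0}. \<Sum>j\<le>nat k.
        sV (of_nat (nat k choose j)) (Y (comp Vg u k) (n + int j) v))"

definition zhu_O ::
  "(complex \<Rightarrow> 'v::ab_group_add \<Rightarrow> 'v) \<Rightarrow> ('v \<Rightarrow> int \<Rightarrow> 'v \<Rightarrow> 'v) \<Rightarrow> (int \<Rightarrow> 'v set) \<Rightarrow> 'v set" where
  "zhu_O sV Y Vg = module.span sV {zhu_res sV Y Vg n u v | n u v. n \<le> -2}"

definition zhu_star ::
  "(complex \<Rightarrow> 'v::ab_group_add \<Rightarrow> 'v) \<Rightarrow> ('v \<Rightarrow> int \<Rightarrow> 'v \<Rightarrow> 'v) \<Rightarrow> (int \<Rightarrow> 'v set)
    \<Rightarrow> 'v \<Rightarrow> 'v \<Rightarrow> 'v" where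
  "zhu_star sV Y Vg u v = zhu_res sV Y Vg (-1) u v"

text \<open>A (unital) module M for A(V) = V/O(V), given by rho u = rho(u + O(V)).\<close>

definition zhu_rep ::
  "(complex \<Rightarrow> 'v::ab_group_add \<Rightarrow> 'v) \<Rightarrow> ('v \<Rightarrow> int \<Rightarrow> 'v \<Rightarrow> 'v) \<Rightarrow> 'v \<Rightarrow> (int \<Rightarrow> 'v set)
    \<Rightarrow> (complex \<Rightarrow> 'm::ab_group_add \<Rightarrow> 'm) \<Rightarrow> ('v \<Rightarrow> 'm \<Rightarrow> 'm) \<Rightarrow> bool" where
  "zhu_rep sV Y vac Vg sM \<rho> \<longleftrightarrow>
     vector_space sM \<and>
     (\<forall>u. Vector_Spaces.linear sM sM (\<rho> u)) \<and>
     (\<forall>w. Vector_Spaces.linear sV sM (\<lambda>u. \<rho> u w)) \<and>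
     (\<forall>u\<in>zhu_O sV Y Vg. \<forall>w. \<rho> u w = 0) \<and>
     (\<forall>u v. \<rho> (zhu_star sV Y Vg u v) = \<rho> u \<circ> \<rho> v) \<and>
     \<rho> vac = id"

text \<open>T(V[t,t^-1]) (x) M is the quotient of the free vector space on words
  u1(m1) ... ur(mr) w (lists of letters (u,m) together with w in M) by the
  multilinearity relations.  We work in the free vector space, represented by
  finitely supported functions, and describe S(M) as its quotient by a
  T(V[t,t^-1])-submodule K (the preimage of the relations, I and J).\<close>

type_synonym ('v, 'm) word = "('v \<times> int) list \<times> 'm"

definition fsupp :: "('b \<Rightarrow> complex) \<Rightarrow> bool" where
  "fsupp f \<longleftrightarrow> finite {b. f b \<noteq> 0}"

definition sgl :: "'b \<Rightarrow> 'b \<Rightarrow> complex" where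
  "sgl b = (\<lambda>x. if x = b then 1 else 0)"

text \<open>Left action of u(m) = u (x) t^m: prefixing the letter (u,m).\<close>

definition tact :: "'v \<Rightarrow> int \<Rightarrow> (('v, 'm) word \<Rightarrow> complex) \<Rightarrow> (('v, 'm) word \<Rightarrow> complex)" where
  "tact u m f = (\<lambda>(ls, w). case ls of [] \<Rightarrow> 0 | x # ls' \<Rightarrow> if x = (u, m) then f (ls', w) else 0)"

definition word_deg :: "(int \<Rightarrow> 'v set) \<Rightarrow> ('v, 'm) word \<Rightarrow> int \<Rightarrow> bool" where
  "word_deg Vg b d \<longleftrightarrow>
     (\<exists>ks. length ks = length (fst b) \<and> (\<forall>i<length ks. fst (fst b ! i) \<in> Vg (ks ! i)) \<and>
           (\<Sum>i<length ks. ks ! i - snd (fst b ! i) - 1) = d)"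

definition Fdeg :: "(int \<Rightarrow> 'v set) \<Rightarrow> int \<Rightarrow> (('v, 'm) word \<Rightarrow> complex) set" where
  "Fdeg Vg d = {f. fsupp f \<and> (\<forall>b. f b \<noteq> 0 \<longrightarrow> word_deg Vg b d)}"

inductive_set tsubmod :: "(('v, 'm) word \<Rightarrow> complex) set \<Rightarrow> (('v, 'm) word \<Rightarrow> complex) set"
  for G :: "(('v, 'm) word \<Rightarrow> complex) set" where
  gen: "g \<in> G \<Longrightarrow> g \<in> tsubmod G"
| zero: "(\<lambda>_. 0) \<in> tsubmod G"
| add: "f \<in> tsubmod G \<Longrightarrow> g \<in> tsubmod G \<Longrightarrow> (\<lambda>x. f x + g x) \<in> tsubmod G"
| smul: "f \<in> tsubmod G \<Longrightarrow> (\<lambda>x. c * f x) \<in> tsubmod G"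
| act: "f \<in> tsubmod G \<Longrightarrow> tact u m f \<in> tsubmod G"

definition mlin_rels ::
  "(complex \<Rightarrow> 'v::ab_group_add \<Rightarrow> 'v) \<Rightarrow> (complex \<Rightarrow> 'm::ab_group_add \<Rightarrow> 'm)
    \<Rightarrow> (('v, 'm) word \<Rightarrow> complex) set" where
  "mlin_rels sV sM =
     {(\<lambda>x. sgl (ls1 @ (sV a u + sV b u', m) # ls2, w) x - a * sgl (ls1 @ (u, m) # ls2, w) x
            - b * sgl (ls1 @ (u', m) # ls2, w) x) | ls1 ls2 a b u u' m w. True} \<union>
     {(\<lambda>x. sgl (ls, sM a w + sM b w') x - a * sgl (ls, w) x - b * sgl (ls, w') x)
        | ls a b w w'. True}"

definition gens1 :: "(int \<Rightarrow> 'v set) \<Rightarrow> (('v, 'm) word \<Rightarrow> complex) set" where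
  "gens1 Vg = {tact u m f | u k m f d. u \<in> Vg k \<and> f \<in> Fdeg Vg d \<and> k - m - 1 + d < 0}"

definition o_t :: "(int \<Rightarrow> 'v::ab_group_add set) \<Rightarrow> 'v \<Rightarrow> 'm \<Rightarrow> ('v, 'm) word \<Rightarrow> complex" where
  "o_t Vg u w = (\<lambda>x. \<Sum>k\<in>{k. comp Vg u k \<noteq> 0}. sgl ([(comp Vg u k, k - 1)], w) x)"

definition gens2 :: "(int \<Rightarrow> 'v::ab_group_add set) \<Rightarrow> ('v \<Rightarrow> 'm \<Rightarrow> 'm)
    \<Rightarrow> (('v, 'm) word \<Rightarrow> complex) set" where
  "gens2 Vg \<rho> = {(\<lambda>x. o_t Vg u w x - sgl ([], \<rho> u w) x) | u w. True}"

definition gens3 :: "('v \<Rightarrow> int \<Rightarrow> 'v \<Rightarrow> 'v) \<Rightarrow> (int \<Rightarrow> 'v set)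
    \<Rightarrow> (('v, 'm) word \<Rightarrow> complex) set" where
  "gens3 Y Vg =
     {(\<lambda>x. tact u p (tact v q f) x -
         (\<Sum>i\<in>{0..kv + d - q - 1}. \<Sum>j\<in>{0..ku + d}.
            ((of_int (p - ku - d)) gchoose (nat i)) * of_nat (nat (ku + d) choose nat j) *
            tact (Y u (p - ku - d - i + j) v) (q + ku + d + i - j) f x))
      | u v ku kv p q f d. u \<in> Vg ku \<and> v \<in> Vg kv \<and> f \<in> Fdeg Vg d \<and>
          kv + d > q \<and> ku - p - 1 + kv - q - 1 + d \<ge> 0}"

text \<open>Generators of J (lifted to the free space; f represents a homogeneous
  element of S_1(M) of degree d).\<close>

definition gensJ :: "('v \<Rightarrow> int \<Rightarrow> 'v \<Rightarrow> 'v) \<Rightarrow> (int \<Rightarrow> 'v set)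
    \<Rightarrow> (('v, 'm) word \<Rightarrow> complex) set" where
  "gensJ Y Vg =
     {(\<lambda>x. \<Sum>j\<in>{0..ku + d}. of_nat (nat (ku + d) choose nat j) *
            tact (Y u (p - i - j) v) (q + i + j) f x)
      | u v ku kv p q i f d. u \<in> Vg ku \<and> v \<in> Vg kv \<and> f \<in> Fdeg Vg d \<and> i \<ge> kv + d - q}"

definition SM_kernel ::
  "(complex \<Rightarrow> 'v::ab_group_add \<Rightarrow> 'v) \<Rightarrow> ('v \<Rightarrow> int \<Rightarrow> 'v \<Rightarrow> 'v) \<Rightarrow> (int \<Rightarrow> 'v set)
    \<Rightarrow> (complex \<Rightarrow> 'm::ab_group_add \<Rightarrow> 'm) \<Rightarrow> ('v \<Rightarrow> 'm \<Rightarrow> 'm) \<Rightarrow> (('v, 'm) word \<Rightarrow> complex) set" where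
  "SM_kernel sV Y Vg sM \<rho> =
     tsubmod (mlin_rels sV sM \<union> gens1 Vg \<union> gens2 Vg \<rho> \<union> gens3 Y Vg \<union> gensJ Y Vg)"

text \<open>The quotient space X/K (X a space of functions, K a subspace), with vertex
  operators induced by YW (u_n acts as YW u n) and grading W_(n) = image of Wg n,
  is an N-gradable weak V-module.  All identities are required modulo K.\<close>

definition Ngradable_weak_module_mod ::
  "(complex \<Rightarrow> 'v::ab_group_add \<Rightarrow> 'v) \<Rightarrow> ('v \<Rightarrow> int \<Rightarrow> 'v \<Rightarrow> 'v) \<Rightarrow> 'v \<Rightarrow> (int \<Rightarrow> 'v set)
    \<Rightarrow> ('b \<Rightarrow> complex) set \<Rightarrow> ('b \<Rightarrow> complex) set
    \<Rightarrow> ('v \<Rightarrow> int \<Rightarrow> ('b \<Rightarrow> complex) \<Rightarrow> ('b \<Rightarrow> complex)) \<Rightarrow> (int \<Rightarrow> ('b \<Rightarrow> complex) set) \<Rightarrow> bool" where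
  "Ngradable_weak_module_mod sV Y vac Vg X K YW Wg \<longleftrightarrow>
     \<comment> \<open>X/K is a well-defined vector space\<close>
     K \<subseteq> X \<and> (\<lambda>_. 0) \<in> K \<and>
     (\<forall>f\<in>X. \<forall>g\<in>X. (\<lambda>x. f x + g x) \<in> X) \<and> (\<forall>f\<in>X. \<forall>c. (\<lambda>x. c * f x) \<in> X) \<and>
     (\<forall>f\<in>K. \<forall>g\<in>K. (\<lambda>x. f x + g x) \<in> K) \<and> (\<forall>f\<in>K. \<forall>c. (\<lambda>x. c * f x) \<in> K) \<and>
     \<comment> \<open>the modes are well-defined on X/K\<close>
     (\<forall>u n. \<forall>f\<in>X. YW u n f \<in> X) \<and> (\<forall>u n. \<forall>f\<in>K. YW u n f \<in> K) \<and>
     \<comment> \<open>linearity of Y_W in u and of each mode\<close>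
     (\<forall>u u' a b n. \<forall>f\<in>X.
        (\<lambda>x. YW (sV a u + sV b u') n f x - a * YW u n f x - b * YW u' n f x) \<in> K) \<and>
     (\<forall>u n a b. \<forall>f\<in>X. \<forall>g\<in>X.
        (\<lambda>x. YW u n (\<lambda>y. a * f y + b * g y) x - a * YW u n f x - b * YW u n g x) \<in> K) \<and>
     \<comment> \<open>truncation\<close>
     (\<forall>u. \<forall>f\<in>X. \<exists>N. \<forall>n\<ge>N. YW u n f \<in> K) \<and>
     \<comment> \<open>vacuum property\<close>
     (\<forall>n. \<forall>f\<in>X. (\<lambda>x. YW vac n f x - (if n = -1 then f x else 0)) \<in> K) \<and>
     \<comment> \<open>Jacobi identity, coefficientwise (Borcherds identity)\<close>
     (\<forall>u v p q r. \<forall>f\<in>X. \<exists>N::nat. \<forall>n\<ge>N.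
        (\<lambda>x. (\<Sum>i\<le>n. ((of_int p) gchoose i) * YW (Y u (r + int i) v) (p + q - int i) f x)
            - (\<Sum>i\<le>n. (-1) ^ i * ((of_int r) gchoose i) *
                 (YW u (p + r - int i) (YW v (q + int i) f) x
                  - (-1) powi r * YW v (q + r - int i) (YW u (p + int i) f) x))) \<in> K) \<and>
     \<comment> \<open>N-grading: W = direct sum of W_(n), n in N\<close>
     (\<forall>n. Wg n \<subseteq> X \<and> (\<lambda>_. 0) \<in> Wg n \<and> (\<forall>f\<in>Wg n. \<forall>g\<in>Wg n. (\<lambda>x. f x + g x) \<in> Wg n) \<and>
          (\<forall>f\<in>Wg n. \<forall>c. (\<lambda>x. c * f x) \<in> Wg n)) \<and>
     (\<forall>n<0. Wg n \<subseteq> K) \<and>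
     (\<forall>f\<in>X. \<exists>S g. finite S \<and> (\<forall>n\<in>S. n \<ge> 0 \<and> g n \<in> Wg n) \<and>
                   (\<lambda>x. f x - (\<Sum>n\<in>S. g n x)) \<in> K) \<and>
     (\<forall>S g. finite S \<and> (\<forall>n\<in>S. g n \<in> Wg n) \<and> (\<lambda>x. \<Sum>n\<in>S. g n x) \<in> K
              \<longrightarrow> (\<forall>n\<in>S. g n \<in> K)) \<and>
     \<comment> \<open>u_n maps W_(j) to W_(j + wt u - n - 1)\<close>
     (\<forall>u k n j f. u \<in> Vg k \<and> f \<in> Wg j \<longrightarrow>
        (\<exists>g\<in>Wg (j + k - n - 1). (\<lambda>x. YW u n f x - g x) \<in> K))"

end

theory Submission
  imports Defs "HOL-Computational_Algebra.Formal_Power_Series" "HOL-Library.Function_Algebras"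
begin

text \<open>
  Fix a linear functional \<open>l\<close> vanishing on the kernel, homogeneous \<open>u\<close>, \<open>v\<close>, \<open>f\<close> and an integer \<open>S\<close>, and
  regard \<open>a p = l (u(p) v(S-p) f)\<close>, \<open>b p = l (v(S-p) u(p) f)\<close> and \<open>c n = l ((u_n v)(S-n) f)\<close> as the
  values on \<open>z ^ p\<close>, \<open>z ^ p\<close> and \<open>(z - 1) ^ n\<close> of functionals on rational functions with poles in
  \<open>{0, 1, \<infinity>}\<close>, defined through expansion at \<open>\<infinity>\<close>, 0 and 1. The Jacobi identity says \<open>c = a - b\<close> on all
  \<open>z ^ p * (z - 1) ^ r\<close>. The relations (3) and J amount to \<open>c = a\<close> when \<open>p\<close> is at least \<open>wt u + deg f\<close>,
  where \<open>b\<close> vanishes. Exchanging \<open>u\<close> and \<open>v\<close> (the substitution \<open>z \<mapsto> 1/z\<close>, realised by skew symmetry of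
  \<open>V\<close>) yields \<open>c = - b\<close> when \<open>p + r \<le> S - wt v - deg f\<close>, where \<open>a\<close> vanishes. Since
  \<open>z = (z - 1) + 1\<close>, the defect satisfies \<open>D (p+1) r = D p (r+1) + D p r\<close>, and the two regions of vanishing
  force \<open>D = 0\<close>.

  The vacuum property follows from relation (3) with \<open>u\<close> the vacuum together with
  \<open>1(-1) w = \<rho> 1 w = w\<close> on \<open>M\<close>. The kernel is graded because all relations other than
  multilinearity are homogeneous.
\<close>

section \<open>Weighted sums of sequences that vanish far to the right\<close>

text \<open>Summing over the support of \<open>x\<close> keeps this finite as soon as
  \<open>x\<close> vanishes far to the right. If \<open>x m\<close> is the value of a functional on
  the \<open>m\<close>-th power of a variable \<open>t\<close>, then \<open>wsum w x s\<close> is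
  its value on \<open>t ^ s\<close> times the power series with coefficients
  \<open>w\<close>.\<close>

definition wsum :: "(nat \<Rightarrow> complex) \<Rightarrow> (int \<Rightarrow> complex) \<Rightarrow> int \<Rightarrow> complex" where
  "wsum w x s = (\<Sum>i\<in>{i. x (s + int i) \<noteq> 0}. w i * x (s + int i))"

definition bin :: "int \<Rightarrow> nat \<Rightarrow> complex" where
  "bin p i = of_int p gchoose i"

text \<open>Coefficients of the \<open>p\<close>-th power of \<open>1 - t\<close>, as
  \<open>bin p\<close> gives those of \<open>1 + t\<close>.\<close>

definition altbin :: "int \<Rightarrow> nat \<Rightarrow> complex" where
  "altbin p i = (-1) ^ i * bin p i"

text \<open>The cut-off \<open>n\<close> may come from the weights as well as from \<open>x\<close>;
  the bound \<open>B\<close> makes the support finite.\<close>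

lemma wsum_eq:
  assumes "\<And>i. n \<le> i \<Longrightarrow> w i * x (s + int i) = 0" "\<forall>m\<ge>B. x m = 0"
  shows "wsum w x s = (\<Sum>i<n. w i * x (s + int i))"
proof -
  define k where "k = max n (nat (B - s))"
  have "x (s + int i) = 0" if "k \<le> i" for i
    using assms(2) that by (auto simp: k_def)
  then have *: "wsum w x s = (\<Sum>i<k. w i * x (s + int i))"
    unfolding wsum_def by (intro sum.mono_neutral_left) (auto simp: not_le[symmetric])
  show ?thesis unfolding *
    by (intro sum.mono_neutral_right) (use assms(1) in \<open>auto simp: k_def not_less\<close>)
qed

lemma wsum_eq':
  assumes "\<And>m. s + int n \<le> m \<Longrightarrow> x m = 0"
  shows "wsum w x s = (\<Sum>i<n. w i * x (s + int i))"
  by (rule wsum_eq) (use assms in auto)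

lemma wsum_zero:
  assumes "\<And>m. s \<le> m \<Longrightarrow> x m = 0"
  shows "wsum w x s = 0"
  using wsum_eq'[of s 0 x w] assms by simp

lemma wsum_cong:
  assumes "\<And>i. w i = w' i" "\<And>m. s \<le> m \<Longrightarrow> x m = y m"
  shows "wsum w x s = wsum w' y s"
  unfolding wsum_def by (rule sum.cong) (use assms in auto)

lemma wsum_shift: "wsum w (\<lambda>j. x (j + t)) s = wsum w x (s + t)"
  by (simp add: wsum_def algebra_simps)

lemma wsum_single:
  assumes "\<And>m. m \<noteq> s + int i \<Longrightarrow> x m = 0"
  shows "wsum w x s = w i * x (s + int i)"
proof -
  have "wsum w x s = (\<Sum>k<Suc i. w k * x (s + int k))"
    by (rule wsum_eq') (use assms in auto)
  also have "\<dots> = (\<Sum>k\<in>{i}. w k * x (s + int k))"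
    by (intro sum.mono_neutral_right) (use assms in auto)
  finally show ?thesis by simp
qed

lemma wsum_delta: "w 0 = 1 \<Longrightarrow> (\<And>i. i > 0 \<Longrightarrow> w i = 0) \<Longrightarrow> (\<forall>m\<ge>B. x m = 0) \<Longrightarrow> wsum w x s = x s"
  using wsum_eq[of 1 w x s B] by auto

text \<open>Cauchy product of the weights. The inner weights may depend on the outer index,
  recovered from \<open>j\<close> as \<open>nat (j - s)\<close>.\<close>

lemma wsum_wsum:
  assumes B: "\<forall>m\<ge>B. x m = 0"
  shows "wsum w (\<lambda>j. wsum (w' (nat (j - s))) x j) s = wsum (\<lambda>l. \<Sum>i\<le>l. w i * w' i (l - i)) x s"
proof -
  define n where "n = nat (B - s)"
  have van: "x m = 0" if "s + int n \<le> m" for m using that B by (auto simp: n_def split: if_splits)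
  have inner: "wsum (w' i) x (s + int i) = (\<Sum>k<n - i. w' i k * x (s + int i + int k))" for i
    by (rule wsum_eq') (rule van, simp add: le_diff_conv2 split: nat_diff_split)
  have "wsum w (\<lambda>j. wsum (w' (nat (j - s))) x j) s
      = (\<Sum>i<n. w i * wsum (w' (nat (s + int i - s))) x (s + int i))"
    by (rule wsum_eq', rule wsum_zero, rule van) simp
  also have "\<dots> = (\<Sum>i<n. \<Sum>k<n - i. w i * w' i k * x (s + int (i + k)))"
    by (simp add: inner sum_distrib_left mult.assoc algebra_simps)
  also have "\<dots> = (\<Sum>(i, k)\<in>(SIGMA i:{..<n}. {..<n - i}). w i * w' i k * x (s + int (i + k)))"
    by (simp add: sum.Sigma)
  also have "(SIGMA i:{..<n}. {..<n - i}) = {(i, j). i + j < n}" by auto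
  also have "(\<Sum>(i, k)\<in>{(i, j). i + j < n}. w i * w' i k * x (s + int (i + k)))
      = (\<Sum>k<n. \<Sum>i\<le>k. w i * w' i (k - i) * x (s + int (i + (k - i))))"
    by (rule sum.triangle_reindex)
  also have "\<dots> = (\<Sum>k<n. (\<Sum>i\<le>k. w i * w' i (k - i)) * x (s + int k))"
    by (simp add: sum_distrib_right)
  also have "\<dots> = wsum (\<lambda>l. \<Sum>i\<le>l. w i * w' i (l - i)) x s"
    by (rule wsum_eq'[symmetric]) (rule van)
  finally show ?thesis .
qed

lemma wsum_alternate:
  "wsum (bin q) (\<lambda>n. - ((-1) powi n * x n)) s = - ((-1) powi s * wsum (altbin q) x s)"
  by (simp add: wsum_def altbin_def sum_distrib_left sum_negf power_int_add mult_ac)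

section \<open>Binomial coefficients with integer upper index as weights\<close>

lemma bin_0_left: "bin 0 i = (if i = 0 then 1 else 0)"
  by (cases i) (auto simp: bin_def)

lemma bin_0_right [simp]: "bin p 0 = 1"
  by (simp add: bin_def)

lemma bin_of_nat: "bin (int n) i = of_nat (n choose i)"
  by (simp add: bin_def binomial_gbinomial)

lemma bin_negated: "bin p k = (-1) ^ k * bin (int k - p - 1) k"
  using gbinomial_negated_upper[of "of_int p :: complex" k] by (simp add: bin_def)

lemma bin_Vandermonde: "(\<Sum>i\<le>l. bin p i * bin q (l - i)) = bin (p + q) l"
  using gbinomial_Vandermonde[of "of_int p :: complex" "of_int q" l]
  by (simp add: bin_def atMost_atLeast0)

text \<open>Negating the upper index of the second factor turns it into
  \<open>int l - X - 1\<close>, which is free of \<open>i\<close>, so Vandermonde applies; a second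
  negation absorbs the sign.\<close>

lemma bin_alt_Vandermonde: "(\<Sum>i\<le>l. altbin q i * bin (X - int i) (l - i)) = bin (X - q) l"
proof -
  have "(\<Sum>i\<le>l. altbin q i * bin (X - int i) (l - i))
      = (\<Sum>i\<le>l. (-1) ^ l * (bin q i * bin (int l - X - 1) (l - i)))"
  proof (rule sum.cong)
    fix i assume "i \<in> {..l}"
    then have i: "i \<le> l" by simp
    have "bin (X - int i) (l - i) = (-1) ^ (l - i) * bin (int l - X - 1) (l - i)"
      using bin_negated[of "X - int i" "l - i"] i by (simp add: of_nat_diff algebra_simps)
    then have "altbin q i * bin (X - int i) (l - i)
        = ((-1) ^ i * (-1) ^ (l - i)) * (bin q i * bin (int l - X - 1) (l - i))"
      by (simp only: altbin_def mult_ac)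
    also have "(-1) ^ i * (-1) ^ (l - i) = ((-1) ^ l :: complex)"
      using i by (metis power_add le_add_diff_inverse)
    finally show "altbin q i * bin (X - int i) (l - i) = (-1) ^ l * (bin q i * bin (int l - X - 1) (l - i))" .
  qed simp
  also have "\<dots> = (-1) ^ l * bin (q + (int l - X - 1)) l"
    by (simp add: bin_Vandermonde flip: sum_distrib_left)
  also have "\<dots> = bin (X - q) l"
    using bin_negated[of "X - q" l] by (simp add: algebra_simps)
  finally show ?thesis .
qed

text \<open>Two successive re-expansions collapse into one. With \<open>X = 0\<close> this inverts
  the expansion in the relations of \<open>gens3\<close>; with \<open>X = S\<close> it composes
  associativity with skew symmetry.\<close>

lemma wsum_altbin_bin:
  assumes "\<forall>m\<ge>B. x m = 0"
  shows "wsum (altbin q) (\<lambda>j. wsum (bin (X - j)) x j) s = wsum (bin (X - s - q)) x s"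
proof -
  have "wsum (altbin q) (\<lambda>j. wsum (bin (X - j)) x j) s
      = wsum (altbin q) (\<lambda>j. wsum (bin (X - s - int (nat (j - s)))) x j) s"
    by (rule wsum_cong) auto
  also have "\<dots> = wsum (bin (X - s - q)) x s"
    using wsum_wsum[OF assms, where w = "altbin q" and w' = "\<lambda>i. bin (X - s - int i)"]
    by (simp add: bin_alt_Vandermonde)
  finally show ?thesis .
qed

text \<open>The hypotheses say that the series of \<open>w'\<close> is \<open>1 + e * t\<close>
  times that of \<open>w\<close>, and multiplication by \<open>t\<close> shifts the starting point.
  The values 1 and -1 of \<open>e\<close> give Pascal's rule for \<open>bin\<close> and
  \<open>altbin\<close>.\<close>

lemma wsum_one_step:
  assumes "\<forall>m\<ge>B. x m = 0" "\<And>i. w' (Suc i) = w (Suc i) + e * w i" "w' 0 = w 0"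
  shows "wsum w' x s = wsum w x s + e * wsum w x (s + 1)"
proof -
  define n where "n = nat (B - s)"
  have van: "x m = 0" if "s + int n \<le> m" for m using that assms(1) by (auto simp: n_def split: if_splits)
  have "wsum w' x s = (\<Sum>i<Suc n. w' i * x (s + int i))" "wsum w x s = (\<Sum>i<Suc n. w i * x (s + int i))"
    "wsum w x (s + 1) = (\<Sum>i<n. w i * x (s + 1 + int i))"
    by (rule wsum_eq', rule van, simp)+
  then show ?thesis unfolding sum.lessThan_Suc_shift using assms(2,3)
    by (simp add: sum.distrib sum_distrib_left algebra_simps)
qed

lemma wsum_bin_Suc:
  assumes "\<forall>m\<ge>B. x m = 0"
  shows "wsum (bin (p + 1)) x s = wsum (bin p) x s + wsum (bin p) x (s + 1)"
  using wsum_one_step[OF assms, where w' = "bin (p + 1)" and w = "bin p" and e = 1]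
    gbinomial_Suc_Suc[of "of_int p :: complex"] by (simp add: bin_def add.commute)

lemma wsum_altbin_Suc:
  assumes "\<forall>m\<ge>B. x m = 0"
  shows "wsum (altbin (p + 1)) x s = wsum (altbin p) x s - wsum (altbin p) x (s + 1)"
  using wsum_one_step[OF assms, where w' = "altbin (p + 1)" and w = "altbin p" and e = "-1" and s = s]
    gbinomial_Suc_Suc[of "of_int p :: complex"] by (simp add: altbin_def bin_def algebra_simps)

lemma wsum_bin_nat:
  assumes "\<forall>m\<ge>B. x m = 0"
  shows "wsum (bin (int N)) x s = (\<Sum>j\<le>N. of_nat (N choose j) * x (s + int j))"
  unfolding lessThan_Suc_atMost[symmetric] bin_of_nat[symmetric]
  by (rule wsum_eq[OF _ assms]) (simp add: bin_of_nat binomial_eq_0)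

lemma sum_atLeastAtMost_int_nat: "(\<Sum>j\<in>{0..int n}. g j) = (\<Sum>k\<le>n. g (int k))"
  by (rule sum.reindex_bij_witness[of _ int nat]) auto

section \<open>From weak associativity to the Jacobi identity\<close>

text \<open>Here \<open>c n\<close> is the value on \<open>(z - 1) ^ n\<close>. Assumption
  \<open>h\<close> is the content of \<open>gensJ\<close>: the value on
  \<open>z ^ N * (z - 1) ^ m\<close> vanishes for small \<open>m\<close>. Assumption
  \<open>a\<close> is the content of \<open>gens3\<close>: \<open>z ^ p\<close> is written as
  \<open>z ^ N\<close> times \<open>((z - 1) + 1) ^ (p - N)\<close>, expanded in descending powers
  of \<open>z - 1\<close>.\<close>

lemma weak_associativity:
  fixes a c :: "int \<Rightarrow> complex"
  assumes c: "\<forall>m\<ge>B. c m = 0"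
    and h: "\<And>m. m \<le> L \<Longrightarrow> wsum (bin N) c m = 0"
    and a: "\<And>p. a p = wsum (bin (p - N)) (\<lambda>j. wsum (bin N) c (-j)) (N - p)"
    and pN: "N \<le> p"
  shows "wsum (bin p) c r = wsum (altbin r) (\<lambda>j. a (-j)) (- (p + r))"
proof -
  define g where "g j = wsum (bin N) c (-j)" for j
  have g: "\<forall>m\<ge>-L. g m = 0" using h by (simp add: g_def)
  have a0: "\<forall>j\<ge>-L - N. a (-j) = 0"
    unfolding a g_def[symmetric] by (intro allI impI wsum_zero) (use g in simp)
  \<comment> \<open>For exponent \<open>N\<close>, expanding \<open>(z - 1) ^ r\<close> in
    descending powers of \<open>z\<close>, and each of these in descending powers of
    \<open>z - 1\<close>, returns \<open>(z - 1) ^ r\<close>. Larger exponents follow from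
    \<open>z = (z - 1) + 1\<close>.\<close>
  have base: "wsum (bin N) c r = wsum (altbin r) (\<lambda>j. a (-j)) (- (N + r))" for r
  proof -
    have "wsum (altbin r) (\<lambda>j. a (-j)) (- (N + r))
        = wsum (altbin r) (\<lambda>j. wsum (bin (0 - (j + N))) g (j + N)) (- (N + r))"
      by (simp add: a g_def[abs_def] algebra_simps)
    also have "\<dots> = wsum (altbin r) (\<lambda>j. wsum (bin (0 - j)) g j) (- r)"
      using wsum_shift[of "altbin r" "\<lambda>j. wsum (bin (0 - j)) g j" N] by simp
    also have "\<dots> = wsum (bin 0) g (-r)" using wsum_altbin_bin[OF g, of r 0 "-r"] by simp
    also have "\<dots> = g (-r)" by (rule wsum_delta[OF _ _ g]) (auto simp: bin_0_left)
    finally show ?thesis by (simp add: g_def)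
  qed
  show ?thesis using pN
  proof (induction p arbitrary: r rule: int_ge_induct)
    case base
    show ?case by (rule \<open>wsum (bin N) c r = wsum (altbin r) (\<lambda>j. a (-j)) (- (N + r))\<close>)
  next
    case (step p)
    have "wsum (bin (p + 1)) c r = wsum (bin p) c r + wsum (bin p) c (r + 1)"
      by (rule wsum_bin_Suc[OF c])
    also have "\<dots> = wsum (altbin r) (\<lambda>j. a (-j)) (- (p + r)) + wsum (altbin (r + 1)) (\<lambda>j. a (-j)) (- (p + (r + 1)))"
      by (simp only: step.IH)
    also have "wsum (altbin (r + 1)) (\<lambda>j. a (-j)) (- (p + (r + 1)))
        = wsum (altbin r) (\<lambda>j. a (-j)) (- (p + (r + 1))) - wsum (altbin r) (\<lambda>j. a (-j)) (- (p + (r + 1)) + 1)"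
      by (rule wsum_altbin_Suc[OF a0])
    finally show ?case by (simp add: algebra_simps)
  qed
qed

text \<open>The three weighted sums are the expansions of \<open>z ^ p * (z - 1) ^ r\<close> at 1,
  at infinity and at 0. Each satisfies the recursion coming from \<open>z = (z - 1) + 1\<close>,
  hence so does their combination \<open>D\<close>.\<close>

lemma jacobi_from_two_associativities:
  fixes a b c :: "int \<Rightarrow> complex"
  assumes a: "\<And>p. p \<le> L \<Longrightarrow> a p = 0" and b: "\<forall>p\<ge>N. b p = 0"
    and c: "\<forall>m\<ge>B. c m = 0"
    and one: "\<And>p r. N \<le> p \<Longrightarrow> wsum (bin p) c r = wsum (altbin r) (\<lambda>j. a (-j)) (- (p + r))"
    and two: "\<And>p r. p + r \<le> L \<Longrightarrow> wsum (bin p) c r = - ((-1) powi r * wsum (altbin r) b p)"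
  shows "wsum (bin p) c r
    = wsum (altbin r) (\<lambda>j. a (-j)) (- (p + r)) - (-1) powi r * wsum (altbin r) b p"
proof -
  have a': "\<forall>m\<ge>-L. a (-m) = 0" using a by simp
  define D where "D p r = wsum (bin p) c r - wsum (altbin r) (\<lambda>j. a (-j)) (- (p + r))
      + (-1) powi r * wsum (altbin r) b p" for p r
  have rec: "D (p + 1) r = D p (r + 1) + D p r" for p r
  proof -
    have 1: "wsum (bin (p + 1)) c r = wsum (bin p) c r + wsum (bin p) c (r + 1)"
      by (rule wsum_bin_Suc[OF c])
    have 2: "wsum (altbin (r + 1)) (\<lambda>j. a (-j)) (- (p + (r + 1)))
        = wsum (altbin r) (\<lambda>j. a (-j)) (- (p + (r + 1))) - wsum (altbin r) (\<lambda>j. a (-j)) (- (p + (r + 1)) + 1)"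
      by (rule wsum_altbin_Suc[OF a'])
    have 3: "wsum (altbin (r + 1)) b p = wsum (altbin r) b p - wsum (altbin r) b (p + 1)"
      by (rule wsum_altbin_Suc[OF b])
    have 4: "(-1) powi (r + 1) = - ((-1) powi r :: complex)" by (simp add: power_int_add)
    show ?thesis unfolding D_def 1 2 3 4 by (simp add: algebra_simps)
  qed
  have high: "D p r = 0" if "N \<le> p" for p r
  proof -
    have "wsum (altbin r) b p = 0" by (rule wsum_zero) (use b that in auto)
    then show ?thesis using one[OF that, of r] by (simp add: D_def)
  qed
  have low: "D p r = 0" if "p + r \<le> L" for p r
  proof -
    have "wsum (altbin r) (\<lambda>j. a (-j)) (- (p + r)) = 0" by (rule wsum_zero) (use a' that in auto)
    then show ?thesis using two[OF that] by (simp add: D_def)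
  qed
  \<comment> \<open>Descent in \<open>p\<close>: once the row above is zero, the recursion reads
    \<open>D p (r + 1) = - D p r\<close>, so the zeros of row \<open>p\<close> in the range
    \<open>p + r \<le> L\<close> spread to all larger \<open>r\<close>.\<close>
  have down: "\<forall>r. D (N - int k) r = 0" for k
  proof (induction k)
    case 0
    show ?case using high by simp
  next
    case (Suc k)
    let ?p = "N - int (Suc k)"
    have step: "D ?p (r + 1) = 0 \<longleftrightarrow> D ?p r = 0" for r
      proof -
      have "D ?p (r + 1) + D ?p r = 0" using rec[of ?p r] Suc by simp
      then show ?thesis by (auto simp: add_eq_0_iff)
    qed
    show ?case
    proof
      fix r
      show "D ?p r = 0"
      proof (cases "?p + r \<le> L")
        case True then show ?thesis by (rule low)
      next
        case False
        then have "L - ?p \<le> r" by simp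
        then show ?thesis
        proof (induction r rule: int_ge_induct)
          case base
          show ?case by (rule low) simp
        next
          case (step r)
          then show ?case using \<open>\<And>r. D ?p (r + 1) = 0 \<longleftrightarrow> D ?p r = 0\<close> by blast
        qed
      qed
    qed
  qed
  have "D p r = 0" using high[of p r] down[of "nat (N - p)"] by (cases "N \<le> p") auto
  moreover have "wsum (bin p) c r = D p r
    + (wsum (altbin r) (\<lambda>j. a (-j)) (- (p + r)) - (-1) powi r * wsum (altbin r) b p)"
    by (simp add: D_def)
  ultimately show ?thesis by simp
qed

section \<open>Functionals separating a subspace\<close>

definition fscale :: "complex \<Rightarrow> ('b \<Rightarrow> complex) \<Rightarrow> 'b \<Rightarrow> complex" where
  "fscale c f = (\<lambda>x. c * f x)"

lemma vector_space_fscale: "vector_space (fscale :: complex \<Rightarrow> ('b \<Rightarrow> complex) \<Rightarrow> _)"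
  by unfold_locales (auto simp: fscale_def fun_eq_iff algebra_simps)

text \<open>These are the linear functionals on the quotient by \<open>K\<close>, pulled back to the
  space of all functions.\<close>

definition annihilator :: "('b \<Rightarrow> complex) set \<Rightarrow> (('b \<Rightarrow> complex) \<Rightarrow> complex) \<Rightarrow> bool" where
  "annihilator K l \<longleftrightarrow> (\<forall>f g. l (\<lambda>x. f x + g x) = l f + l g) \<and> (\<forall>c f. l (\<lambda>x. c * f x) = c * l f)
     \<and> (\<forall>f\<in>K. l f = 0)"

text \<open>A basis of \<open>K\<close> stays independent when an \<open>f\<close> outside
  \<open>K\<close> is added, so some functional is 1 on \<open>f\<close> and 0 on \<open>K\<close>.
  Membership in \<open>K\<close> thereby reduces to identities between complex numbers, to which the
  lemmas on weighted sums apply.\<close>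

lemma separating_functional:
  assumes K0: "(\<lambda>_. 0) \<in> K" and Ka: "\<And>f g. f \<in> K \<Longrightarrow> g \<in> K \<Longrightarrow> (\<lambda>x. f x + g x) \<in> K"
    and Ks: "\<And>f c. f \<in> K \<Longrightarrow> (\<lambda>x. c * f x) \<in> K"
    and f: "\<And>l. annihilator K l \<Longrightarrow> l f = 0"
  shows "f \<in> K"
proof (rule ccontr)
  assume "f \<notin> K"
  interpret F: vector_space "fscale :: complex \<Rightarrow> ('a \<Rightarrow> complex) \<Rightarrow> _" by (rule vector_space_fscale)
  interpret C: vector_space "(*) :: complex \<Rightarrow> complex \<Rightarrow> complex"
    by unfold_locales (auto simp: algebra_simps)
  interpret FC: vector_space_pair "fscale :: complex \<Rightarrow> ('a \<Rightarrow> complex) \<Rightarrow> _" "(*) :: complex \<Rightarrow> complex \<Rightarrow> complex" ..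
  have sub: "F.subspace K"
    by (rule F.subspaceI; unfold fscale_def plus_fun_def zero_fun_def) (rule K0 Ka Ks; assumption)+
  obtain B where B: "B \<subseteq> K" "F.independent B" "K \<subseteq> F.span B"
    by (rule F.basis_exists[of K])
  have span: "F.span B = K" using B sub by (simp add: F.span_minimal subset_antisym)
  have ind: "F.independent (insert f B)" using B(2) \<open>f \<notin> K\<close> span by (simp add: F.independent_insertI)
  define l where "l = FC.construct (insert f B) (\<lambda>b. if b = f then 1 else 0)"
  have lin: "Vector_Spaces.linear fscale (*) l" unfolding l_def by (rule FC.linear_construct[OF ind])
  have lf: "l f = 1" unfolding l_def by (subst FC.construct_basis[OF ind]) auto
  have lK: "l g = 0" if "g \<in> K" for g
  proof (rule FC.linear_eq_0_on_span[OF lin])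
    show "g \<in> F.span B" using that span by simp
    show "l b = 0" if "b \<in> B" for b
      unfolding l_def by (subst FC.construct_basis[OF ind]) (use that B(1) \<open>f \<notin> K\<close> in auto)
  qed
  have "annihilator K l"
    unfolding annihilator_def using FC.linear_add[OF lin] FC.linear_scale[OF lin] lK
    by (simp add: fscale_def plus_fun_def)
  then show False using f[of l] lf by simp
qed

section \<open>Annihilating functionals\<close>

lemma annihilator_add: "annihilator K l \<Longrightarrow> l (\<lambda>x. f x + g x) = l f + l g"
  and annihilator_scale: "annihilator K l \<Longrightarrow> l (\<lambda>x. c * f x) = c * l f"
  and annihilator_mem: "annihilator K l \<Longrightarrow> f \<in> K \<Longrightarrow> l f = 0"
  by (simp_all add: annihilator_def)

lemma annihilator_zero: "annihilator K l \<Longrightarrow> l (\<lambda>x. 0) = 0"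
  using annihilator_scale[of K l 0 "\<lambda>_. 0"] by simp

lemma annihilator_diff: "annihilator K l \<Longrightarrow> l (\<lambda>x. f x - g x) = l f - l g"
  using annihilator_add[of K l f "\<lambda>x. (-1) * g x"] annihilator_scale[of K l "-1" g] by simp

lemma annihilator_sum:
  assumes "annihilator K l"
  shows "l (\<lambda>x. \<Sum>i\<in>I. f i x) = (\<Sum>i\<in>I. l (f i))"
  by (induction I rule: infinite_finite_induct)
    (simp_all add: annihilator_zero[OF assms] annihilator_add[OF assms])

lemmas annihilator_linear = annihilator_add annihilator_scale annihilator_zero annihilator_diff annihilator_sum

section \<open>The word space\<close>

lemma tact_sgl: "tact u m (sgl (ls, w)) = sgl ((u, m) # ls, w)"
  by (auto simp: tact_def sgl_def fun_eq_iff split: list.splits)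

lemma tact_Cons: "tact u m f ((u', m') # ls, w) = (if (u', m') = (u, m) then f (ls, w) else 0)"
  by (simp add: tact_def)

lemma tact_add: "tact u m (\<lambda>x. f x + g x) = (\<lambda>x. tact u m f x + tact u m g x)"
  by (auto simp: tact_def fun_eq_iff split: list.splits)

lemma tact_scale: "tact u m (\<lambda>x. c * f x) = (\<lambda>x. c * tact u m f x)"
  by (auto simp: tact_def fun_eq_iff split: list.splits)

lemma tact_zero: "tact u m (\<lambda>x. 0) = (\<lambda>x. 0)"
  by (auto simp: tact_def fun_eq_iff split: list.splits)

lemma tact_sum: "tact u m (\<lambda>x. \<Sum>i\<in>I. f i x) = (\<lambda>x. \<Sum>i\<in>I. tact u m (f i) x)"
  by (induction I rule: infinite_finite_induct) (simp_all add: tact_zero tact_add)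

lemma supp_tact:
  "{b. tact u m f b \<noteq> 0} = (\<lambda>b. ((u, m) # fst b, snd b)) ` {b. f b \<noteq> 0}"
proof (intro equalityI subsetI)
  fix b assume "b \<in> {b. tact u m f b \<noteq> 0}"
  then obtain ls where "fst b = (u, m) # ls" "f (ls, snd b) \<noteq> 0"
    by (cases b) (auto simp: tact_def split: list.splits if_splits)
  then show "b \<in> (\<lambda>b. ((u, m) # fst b, snd b)) ` {b. f b \<noteq> 0}"
    by (intro image_eqI[of _ _ "(ls, snd b)"]) (auto simp: prod_eq_iff)
qed (auto simp: tact_def)

lemma fsupp_tact: "fsupp f \<Longrightarrow> fsupp (tact u m f)"
  unfolding fsupp_def supp_tact by (rule finite_imageI)

lemma fsupp_add: "fsupp f \<Longrightarrow> fsupp g \<Longrightarrow> fsupp (\<lambda>x. f x + g x)"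
  unfolding fsupp_def by (rule finite_subset[of _ "{b. f b \<noteq> 0} \<union> {b. g b \<noteq> 0}"]) auto

lemma fsupp_scale: "fsupp f \<Longrightarrow> fsupp (\<lambda>x. c * f x)"
  unfolding fsupp_def by (rule finite_subset[of _ "{b. f b \<noteq> 0}"]) auto

lemma fsupp_zero: "fsupp (\<lambda>x. 0)"
  by (simp add: fsupp_def)

lemma fsupp_diff: "fsupp f \<Longrightarrow> fsupp g \<Longrightarrow> fsupp (\<lambda>x. f x - g x)"
  unfolding fsupp_def by (rule finite_subset[of _ "{b. f b \<noteq> 0} \<union> {b. g b \<noteq> 0}"]) auto

lemma fsupp_sum: "(\<And>i. i \<in> I \<Longrightarrow> fsupp (f i)) \<Longrightarrow> fsupp (\<lambda>x. \<Sum>i\<in>I. f i x)"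
  by (induction I rule: infinite_finite_induct) (simp_all add: fsupp_zero fsupp_add)

lemma fsupp_sgl: "fsupp (sgl b)"
  by (simp add: fsupp_def sgl_def)

lemma fsupp_expand:
  assumes "fsupp f"
  shows "f = (\<lambda>x. \<Sum>b\<in>{b. f b \<noteq> 0}. f b * sgl b x)"
proof
  fix x
  have "(\<Sum>b\<in>{b. f b \<noteq> 0}. f b * sgl b x) = (\<Sum>b\<in>{b. f b \<noteq> 0}. if x = b then f b else 0)"
    by (rule sum.cong) (auto simp: sgl_def)
  also have "\<dots> = f x" using assms by (simp add: fsupp_def)
  finally show "f x = (\<Sum>b\<in>{b. f b \<noteq> 0}. f b * sgl b x)" ..
qed

lemma word_deg_Nil: "word_deg Vg ([], w) d \<longleftrightarrow> d = 0"
  by (auto simp: word_deg_def)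

text \<open>The weight \<open>k\<close> is quantified because the degree of a word need not be
  unique: the zero vector lies in every \<open>Vg k\<close>.\<close>

lemma word_deg_Cons:
  "word_deg Vg ((u, m) # ls, w) d \<longleftrightarrow> (\<exists>k. u \<in> Vg k \<and> word_deg Vg (ls, w) (d - (k - m - 1)))"
proof
  assume "word_deg Vg ((u, m) # ls, w) d"
  then obtain ks where ks: "length ks = Suc (length ls)"
    "\<forall>i<length ks. fst (((u, m) # ls) ! i) \<in> Vg (ks ! i)"
    "(\<Sum>i<length ks. ks ! i - snd (((u, m) # ls) ! i) - 1) = d"
    by (auto simp: word_deg_def)
  obtain k ks' where k: "ks = k # ks'" using ks(1) by (cases ks) auto
  have "u \<in> Vg k" using ks(2) k by force
  moreover have "word_deg Vg (ls, w) (d - (k - m - 1))"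
    unfolding word_deg_def
  proof (intro exI conjI allI impI)
    show "length ks' = length (fst (ls, w))" using ks k by simp
    show "fst (fst (ls, w) ! i) \<in> Vg (ks' ! i)" if "i < length ks'" for i
      using ks(2) k that by (force dest: spec[of _ "Suc i"])
    show "(\<Sum>i<length ks'. ks' ! i - snd (fst (ls, w) ! i) - 1) = d - (k - m - 1)"
      using ks(3) unfolding k by (simp add: sum.lessThan_Suc_shift del: sum.lessThan_Suc)
  qed
  ultimately show "\<exists>k. u \<in> Vg k \<and> word_deg Vg (ls, w) (d - (k - m - 1))" by blast
next
  assume "\<exists>k. u \<in> Vg k \<and> word_deg Vg (ls, w) (d - (k - m - 1))"
  then obtain k ks where k: "u \<in> Vg k" and ks: "length ks = length ls"
    "\<forall>i<length ks. fst (ls ! i) \<in> Vg (ks ! i)"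
    "(\<Sum>i<length ks. ks ! i - snd (ls ! i) - 1) = d - (k - m - 1)"
    by (auto simp: word_deg_def)
  show "word_deg Vg ((u, m) # ls, w) d"
    unfolding word_deg_def
  proof (intro exI[of _ "k # ks"] conjI allI impI)
    show "fst (fst ((u, m) # ls, w) ! i) \<in> Vg ((k # ks) ! i)" if "i < length (k # ks)" for i
      using k ks that by (cases i) auto
    show "(\<Sum>i<length (k # ks). (k # ks) ! i - snd (fst ((u, m) # ls, w) ! i) - 1) = d"
      using ks(3) by (simp add: sum.lessThan_Suc_shift del: sum.lessThan_Suc)
  qed (use ks in auto)
qed

lemma Fdeg_fsupp: "f \<in> Fdeg Vg d \<Longrightarrow> fsupp f"
  by (simp add: Fdeg_def)

lemma Fdeg_add: "f \<in> Fdeg Vg d \<Longrightarrow> g \<in> Fdeg Vg d \<Longrightarrow> (\<lambda>x. f x + g x) \<in> Fdeg Vg d"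
  unfolding Fdeg_def by (auto simp: fsupp_add) (metis add.right_neutral)

lemma Fdeg_scale: "f \<in> Fdeg Vg d \<Longrightarrow> (\<lambda>x. c * f x) \<in> Fdeg Vg d"
  by (auto simp: Fdeg_def fsupp_scale)

lemma Fdeg_zero: "(\<lambda>x. 0) \<in> Fdeg Vg d"
  by (auto simp: Fdeg_def fsupp_zero)

lemma Fdeg_sum: "(\<And>i. i \<in> I \<Longrightarrow> f i \<in> Fdeg Vg d) \<Longrightarrow> (\<lambda>x. \<Sum>i\<in>I. f i x) \<in> Fdeg Vg d"
  by (induction I rule: infinite_finite_induct) (simp_all add: Fdeg_zero Fdeg_add)

lemma Fdeg_diff: "f \<in> Fdeg Vg d \<Longrightarrow> g \<in> Fdeg Vg d \<Longrightarrow> (\<lambda>x. f x - g x) \<in> Fdeg Vg d"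
  using Fdeg_add[of f Vg d "\<lambda>x. (-1) * g x"] Fdeg_scale[of g Vg d "-1"] by simp

lemma Fdeg_tact:
  assumes "u \<in> Vg k" "f \<in> Fdeg Vg d"
  shows "tact u m f \<in> Fdeg Vg (k - m - 1 + d)"
  unfolding Fdeg_def
proof (intro CollectI conjI allI impI)
  show "fsupp (tact u m f)" using assms(2) by (simp add: Fdeg_def fsupp_tact)
  fix b assume "tact u m f b \<noteq> 0"
  then have "b \<in> (\<lambda>b. ((u, m) # fst b, snd b)) ` {b. f b \<noteq> 0}" by (simp flip: supp_tact)
  then obtain b' where b': "b = ((u, m) # fst b', snd b')" "f b' \<noteq> 0" by auto
  then have "word_deg Vg b' d" using assms(2) unfolding Fdeg_def by blast
  then show "word_deg Vg b (k - m - 1 + d)" using assms(1) b' by (auto simp: word_deg_Cons)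
qed

lemma Fdeg_sgl: "word_deg Vg b d \<Longrightarrow> sgl b \<in> Fdeg Vg d"
  by (simp add: Fdeg_def fsupp_sgl) (simp add: sgl_def)

section \<open>Graded vertex algebras\<close>

locale zhu_setup =
  fixes sV :: "complex \<Rightarrow> 'v::ab_group_add \<Rightarrow> 'v"
    and Y :: "'v \<Rightarrow> int \<Rightarrow> 'v \<Rightarrow> 'v"
    and vac :: 'v
    and Vg :: "int \<Rightarrow> 'v set"
    and L0 :: "'v \<Rightarrow> 'v"
    and sM :: "complex \<Rightarrow> 'm::ab_group_add \<Rightarrow> 'm"
    and \<rho> :: "'v \<Rightarrow> 'm \<Rightarrow> 'm"
  assumes gva: "graded_vertex_algebra sV Y vac Vg L0"
    and zr: "zhu_rep sV Y vac Vg sM \<rho>"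
begin

lemma va: "vertex_algebra sV Y vac"
  using gva by (simp add: graded_vertex_algebra_def)

sublocale V: vector_space sV
  using va by (simp add: vertex_algebra_def)

lemma Y_linear_right: "Vector_Spaces.linear sV sV (Y u n)"
  and Y_linear_left: "Vector_Spaces.linear sV sV (\<lambda>u. Y u n v)"
  and vac_left: "Y vac n v = (if n = -1 then v else 0)"
  and vac_right: "0 \<le> n \<Longrightarrow> Y u n vac = 0" "Y u (-1) vac = u"
  using va by (simp_all add: vertex_algebra_def)

lemma Y_right: "Y u n (x + y) = Y u n x + Y u n y" "Y u n (sV c x) = sV c (Y u n x)" "Y u n 0 = 0"
proof -
  interpret Vector_Spaces.linear sV sV "Y u n" by (rule Y_linear_right)
  show "Y u n (x + y) = Y u n x + Y u n y" "Y u n (sV c x) = sV c (Y u n x)" "Y u n 0 = 0"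
    by (simp_all add: add scale zero)
qed

lemma Y_left: "Y (x + y) n v = Y x n v + Y y n v" "Y (sV c x) n v = sV c (Y x n v)" "Y 0 n v = 0"
proof -
  interpret Vector_Spaces.linear sV sV "\<lambda>u. Y u n v" by (rule Y_linear_left)
  show "Y (x + y) n v = Y x n v + Y y n v" "Y (sV c x) n v = sV c (Y x n v)" "Y 0 n v = 0"
    by (simp_all add: add scale zero)
qed

lemma Vg_subspace: "V.subspace (Vg n)"
  and Vg_neg: "n < 0 \<Longrightarrow> Vg n = {0}"
  and L0_Vg: "u \<in> Vg n \<Longrightarrow> L0 u = sV (of_int n) u"
  and L0_linear: "Vector_Spaces.linear sV sV L0"
  and L0_Y: "L0 (Y u n v) - Y u n (L0 v) = sV (of_int (- n - 1)) (Y u n v) + Y (L0 u) n v"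
  and decomp_unique: "\<exists>!c. is_decomp Vg v c"
  using gva by (simp_all add: graded_vertex_algebra_def)

lemma Vg_zero: "0 \<in> Vg n"
  by (rule V.subspace_0[OF Vg_subspace])

lemma is_decomp_comp: "is_decomp Vg v (comp Vg v)"
  unfolding comp_def by (rule theI'[OF decomp_unique])

lemma comp_finite: "finite {k. comp Vg v k \<noteq> 0}"
  and comp_mem: "comp Vg v k \<in> Vg k"
  and comp_sum: "v = (\<Sum>k\<in>{k. comp Vg v k \<noteq> 0}. comp Vg v k)"
  using is_decomp_comp[of v] by (simp_all add: is_decomp_def)

lemma comp_eqI:
  assumes "finite F" "\<And>n. n \<notin> F \<Longrightarrow> c n = 0" "\<And>n. c n \<in> Vg n" "v = (\<Sum>n\<in>F. c n)"
  shows "comp Vg v = c"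
proof -
  have "is_decomp Vg v c"
    unfolding is_decomp_def
  proof (intro conjI allI)
    show "finite {n. c n \<noteq> 0}" by (rule finite_subset[OF _ assms(1)]) (use assms(2) in auto)
    show "v = (\<Sum>n\<in>{n. c n \<noteq> 0}. c n)"
      unfolding assms(4) by (rule sum.mono_neutral_right) (use assms in auto)
  qed (rule assms(3))
  then show ?thesis using is_decomp_comp decomp_unique by blast
qed

lemma comp_homogeneous:
  assumes "u \<in> Vg k"
  shows "comp Vg u = (\<lambda>n. if n = k then u else 0)"
  by (rule comp_eqI[of "{k}"]) (use assms Vg_zero in auto)

lemma comp_sum_superset:
  assumes "finite F" "{k. comp Vg v k \<noteq> 0} \<subseteq> F"
  shows "v = (\<Sum>k\<in>F. comp Vg v k)"
proof (rule trans[OF comp_sum])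
  show "(\<Sum>k\<in>{k. comp Vg v k \<noteq> 0}. comp Vg v k) = (\<Sum>k\<in>F. comp Vg v k)"
    by (rule sum.mono_neutral_left) (use assms in auto)
qed

lemma comp_linear: "comp Vg (sV a u + sV b v) = (\<lambda>k. sV a (comp Vg u k) + sV b (comp Vg v k))"
proof (rule comp_eqI)
  let ?F = "{k. comp Vg u k \<noteq> 0} \<union> {k. comp Vg v k \<noteq> 0}"
  show F: "finite ?F" using comp_finite by blast
  show "sV a (comp Vg u n) + sV b (comp Vg v n) \<in> Vg n" for n
    by (intro V.subspace_add V.subspace_scale Vg_subspace comp_mem)
  have u: "u = (\<Sum>k\<in>?F. comp Vg u k)" and v: "v = (\<Sum>k\<in>?F. comp Vg v k)"
    by (rule comp_sum_superset[OF F], blast)+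
  show "sV a u + sV b v = (\<Sum>k\<in>?F. sV a (comp Vg u k) + sV b (comp Vg v k))"
    unfolding sum.distrib V.scale_sum_right[symmetric]
    by (rule arg_cong2[where f = "(+)"]; rule arg_cong) (rule u v)+
qed auto

text \<open>Computing the components of \<open>L0 x\<close> in two ways shows that \<open>n\<close>
  times \<open>c n\<close> equals \<open>k\<close> times \<open>c n\<close>, so only the component
  of degree \<open>k\<close> survives.\<close>

lemma L0_eigen_mem:
  assumes "L0 x = sV (of_int k) x"
  shows "x \<in> Vg k"
proof -
  define c where "c = comp Vg x"
  let ?F = "{n. c n \<noteq> 0}"
  interpret L0: Vector_Spaces.linear sV sV L0 by (rule L0_linear)
  have fin: "finite ?F" and cm: "\<And>n. c n \<in> Vg n" and x: "x = (\<Sum>n\<in>?F. c n)"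
    unfolding c_def by (rule comp_finite comp_mem comp_sum)+
  have "L0 x = (\<Sum>n\<in>?F. L0 (c n))" using arg_cong[OF x, of L0] by (simp only: L0.sum)
  also have "\<dots> = (\<Sum>n\<in>?F. sV (of_int n) (c n))" using L0_Vg[OF cm] by simp
  finally have 1: "comp Vg (L0 x) = (\<lambda>n. sV (of_int n) (c n))"
    by (intro comp_eqI[OF fin]) (auto intro: V.subspace_scale Vg_subspace cm)
  have "comp Vg (L0 x) = (\<lambda>n. sV (of_int k) (c n))"
    unfolding assms using comp_linear[of "of_int k" x 0 0] by (simp add: c_def)
  then have eq: "sV (of_int n) (c n) = sV (of_int k) (c n)" for n using 1 by metis
  have "c n = 0" if "n \<noteq> k" for n
    using eq[of n] that by (simp add: V.scale_right_imp_eq)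
  then have "?F \<subseteq> {k}" by auto
  then have "x = (\<Sum>n\<in>{k}. c n)" unfolding c_def by (intro comp_sum_superset) (auto simp: c_def)
  then show ?thesis using cm[of k] by simp
qed

lemma Y_mem_Vg:
  assumes "u \<in> Vg k" "v \<in> Vg l"
  shows "Y u n v \<in> Vg (k + l - n - 1)"
proof (rule L0_eigen_mem)
  have "L0 (Y u n v) = Y u n (L0 v) + (sV (of_int (- n - 1)) (Y u n v) + Y (L0 u) n v)"
    using L0_Y[of u n v] by (simp add: algebra_simps)
  also have "\<dots> = sV (of_int l) (Y u n v) + (sV (of_int (- n - 1)) (Y u n v) + sV (of_int k) (Y u n v))"
    using L0_Vg[OF assms(1)] L0_Vg[OF assms(2)] by (simp add: Y_right Y_left)
  also have "\<dots> = sV (of_int l + (of_int (- n - 1) + of_int k)) (Y u n v)"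
    by (simp only: V.scale_left_distrib)
  also have "of_int l + (of_int (- n - 1) + of_int k) = (of_int (k + l - n - 1) :: complex)" by simp
  finally show "L0 (Y u n v) = sV (of_int (k + l - n - 1)) (Y u n v)" .
qed

lemma vac_mem: "vac \<in> Vg 0"
proof (rule L0_eigen_mem)
  \<comment> \<open>For mode -1 of the vacuum, both terms on the left of the commutator formula are
    \<open>L0 vac\<close>, and the scalar on the right is 0.\<close>
  have "Y (L0 vac) (-1) vac = 0" using L0_Y[of vac "-1" vac] by (simp add: vac_left)
  then show "L0 vac = sV (of_int 0) vac" by (simp add: vac_right)
qed

lemma borcherds:
  "\<exists>N::nat. \<forall>n\<ge>N.
        (\<Sum>i\<le>n. sV ((of_int p) gchoose i) (Y (Y u (r + int i) v) (p + q - int i) w)) =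
        (\<Sum>i\<le>n. sV ((-1) ^ i * ((of_int r) gchoose i))
            (Y u (p + r - int i) (Y v (q + int i) w)
             - sV ((-1) powi r) (Y v (q + r - int i) (Y u (p + int i) w))))"
  using va unfolding vertex_algebra_def by (elim conjE) (erule allE)+

text \<open>\<open>Y a (-1 - int i) vac\<close> is the \<open>i\<close>-th divided power of the
  translation operator at \<open>a\<close>. The identity is Borcherds' identity at
  \<open>p = -1\<close>, \<open>q = 0\<close> on the vacuum: the creation property leaves on the
  right only the second term with \<open>i = 0\<close>.\<close>

lemma skew_symmetry:
  "\<exists>N. \<forall>n\<ge>N. (\<Sum>i\<le>n. sV ((-1) ^ i) (Y (Y u (r + int i) v) (-1 - int i) vac))
    = - sV ((-1) powi r) (Y v r u)"
proof -
  have gb: "(-1 :: complex) gchoose i = (-1) ^ i" for i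
    using gbinomial_minus[of "1 :: complex" i] by (simp flip: binomial_gbinomial)
  obtain N where N: "\<forall>n\<ge>N.
        (\<Sum>i\<le>n. sV ((of_int (-1)) gchoose i) (Y (Y u (r + int i) v) (-1 + 0 - int i) vac)) =
        (\<Sum>i\<le>n. sV ((-1) ^ i * ((of_int r) gchoose i))
            (Y u (-1 + r - int i) (Y v (0 + int i) vac)
             - sV ((-1) powi r) (Y v (0 + r - int i) (Y u (-1 + int i) vac))))"
    using borcherds[of "-1" u r v 0 vac] by blast
  have "(\<Sum>i\<le>n. sV ((-1) ^ i * ((of_int r) gchoose i))
            (Y u (-1 + r - int i) (Y v (0 + int i) vac)
             - sV ((-1) powi r) (Y v (0 + r - int i) (Y u (-1 + int i) vac))))
      = - sV ((-1) powi r) (Y v r u)" for n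
    by (subst sum.atMost_shift) (simp add: vac_right Y_right)
  then show ?thesis using N by (auto simp: gb)
qed

section \<open>The kernel and its annihilating functionals\<close>

definition K :: "(('v, 'm) word \<Rightarrow> complex) set" where
  "K = SM_kernel sV Y Vg sM \<rho>"

lemma K_zero: "(\<lambda>x. 0) \<in> K"
  and K_add: "f \<in> K \<Longrightarrow> g \<in> K \<Longrightarrow> (\<lambda>x. f x + g x) \<in> K"
  and K_scale: "f \<in> K \<Longrightarrow> (\<lambda>x. c * f x) \<in> K"
  and K_tact: "f \<in> K \<Longrightarrow> tact u m f \<in> K"
  unfolding K_def SM_kernel_def by (rule tsubmod.zero tsubmod.add tsubmod.smul tsubmod.act; assumption)+

lemma K_gen: "g \<in> mlin_rels sV sM \<union> gens1 Vg \<union> gens2 Vg \<rho> \<union> gens3 Y Vg \<union> gensJ Y Vg \<Longrightarrow> g \<in> K"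
  unfolding K_def SM_kernel_def by (rule tsubmod.gen)

lemma K_I: "(\<And>l. annihilator K l \<Longrightarrow> l f = 0) \<Longrightarrow> f \<in> K"
  by (rule separating_functional[OF K_zero K_add K_scale])

text \<open>As \<open>K\<close> is stable under \<open>tact\<close>, a prefixed letter can be
  absorbed into the functional. Identities proved for all annihilators therefore hold behind any
  prefix.\<close>

lemma annihilator_tact: "annihilator K l \<Longrightarrow> annihilator K (\<lambda>f. l (tact u m f))"
  by (simp add: annihilator_def tact_add tact_scale K_tact)

lemma ann_fsupp:
  assumes "annihilator K l" "fsupp f"
  shows "l f = (\<Sum>b\<in>{b. f b \<noteq> 0}. f b * l (sgl b))"
proof -
  have "l f = l (\<lambda>x. \<Sum>b\<in>{b. f b \<noteq> 0}. f b * sgl b x)"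
    using fsupp_expand[OF assms(2)] by (rule arg_cong)
  also have "\<dots> = (\<Sum>b\<in>{b. f b \<noteq> 0}. f b * l (sgl b))"
    by (simp add: annihilator_linear[OF assms(1)])
  finally show ?thesis .
qed

lemma ann_letter:
  assumes "annihilator K l" "fsupp f"
  shows "l (tact (sV a u + sV b u') m f) = a * l (tact u m f) + b * l (tact u' m f)"
proof -
  have "l (tact (sV a u + sV b u') m (sgl b')) = a * l (tact u m (sgl b')) + b * l (tact u' m (sgl b'))" for b'
  proof -
    obtain ls w where b': "b' = (ls, w)" by (cases b')
    have "(\<lambda>x. sgl ([] @ (sV a u + sV b u', m) # ls, w) x - a * sgl ([] @ (u, m) # ls, w) x
            - b * sgl ([] @ (u', m) # ls, w) x) \<in> K"
      by (rule K_gen) (unfold mlin_rels_def, blast)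
    from annihilator_mem[OF assms(1) this] show ?thesis
      by (simp add: annihilator_linear[OF assms(1)] b' tact_sgl algebra_simps)
  qed
  then show ?thesis
    using ann_fsupp[OF annihilator_tact[OF assms(1)] assms(2)]
    by (simp add: algebra_simps sum.distrib sum_distrib_left)
qed

lemma ann_letter_add: "annihilator K l \<Longrightarrow> fsupp f \<Longrightarrow> l (tact (u + u') m f) = l (tact u m f) + l (tact u' m f)"
  and ann_letter_scale: "annihilator K l \<Longrightarrow> fsupp f \<Longrightarrow> l (tact (sV a u) m f) = a * l (tact u m f)"
  and ann_letter_zero: "annihilator K l \<Longrightarrow> fsupp f \<Longrightarrow> l (tact 0 m f) = 0"
  using ann_letter[of l f 1 u 1 u' m] ann_letter[of l f a u 0 u m] ann_letter[of l f 0 u 0 u m]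
  by simp_all

lemma ann_letter_uminus: "annihilator K l \<Longrightarrow> fsupp f \<Longrightarrow> l (tact (- u) m f) = - l (tact u m f)"
  using ann_letter_scale[of l f "-1" u m] by simp

lemma ann_letter_sum:
  "annihilator K l \<Longrightarrow> fsupp f \<Longrightarrow> l (tact (\<Sum>i\<in>I. u i) m f) = (\<Sum>i\<in>I. l (tact (u i) m f))"
  by (induction I rule: infinite_finite_induct) (simp_all add: ann_letter_zero ann_letter_add)

lemma ann_letter_comp:
  assumes "annihilator K l" "fsupp f"
  shows "l (tact u m f) = (\<Sum>k\<in>{k. comp Vg u k \<noteq> 0}. l (tact (comp Vg u k) m f))"
  using arg_cong[OF comp_sum[of u], of "\<lambda>u. l (tact u m f)"] by (simp only: ann_letter_sum[OF assms])

lemma o_t_Fdeg: "o_t Vg u w \<in> Fdeg Vg 0"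
proof -
  have "sgl ([(comp Vg u k, k - 1)], w) \<in> Fdeg Vg 0" for k
    by (rule Fdeg_sgl) (auto simp: word_deg_Cons word_deg_Nil intro!: exI[of _ k] comp_mem)
  then show ?thesis unfolding o_t_def by (intro Fdeg_sum)
qed

text \<open>In every sum the shift in the mode of \<open>Y u\<close> is compensated by the shift in
  the mode of the letter, so all terms have the same degree.\<close>

lemma homogeneous_generators:
  assumes "g \<in> gens1 Vg \<union> gens2 Vg \<rho> \<union> gens3 Y Vg \<union> gensJ Y Vg"
  shows "\<exists>d. g \<in> Fdeg Vg d"
proof -
  consider (1) "g \<in> gens1 Vg" | (2) "g \<in> gens2 Vg \<rho>" | (3) "g \<in> gens3 Y Vg" | (J) "g \<in> gensJ Y Vg"
    using assms by blast
  then show ?thesis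
  proof cases
    case 1
    then show ?thesis by (auto simp: gens1_def intro: Fdeg_tact)
  next
    case 2
    then obtain u w where "g = (\<lambda>x. o_t Vg u w x - sgl ([], \<rho> u w) x)" by (auto simp: gens2_def)
    then have "g \<in> Fdeg Vg 0"
      by (auto intro!: Fdeg_diff o_t_Fdeg Fdeg_sgl simp: word_deg_Nil)
    then show ?thesis ..
  next
    case 3
    then obtain u v ku kv p q f d where g: "g = (\<lambda>x. tact u p (tact v q f) x -
         (\<Sum>i\<in>{0..kv + d - q - 1}. \<Sum>j\<in>{0..ku + d}.
            ((of_int (p - ku - d)) gchoose (nat i)) * of_nat (nat (ku + d) choose nat j) *
            tact (Y u (p - ku - d - i + j) v) (q + ku + d + i - j) f x))"
      and m: "u \<in> Vg ku" "v \<in> Vg kv" "f \<in> Fdeg Vg d" unfolding gens3_def by blast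
    have "tact (Y u (p - ku - d - i + j) v) (q + ku + d + i - j) f \<in> Fdeg Vg (ku - p - 1 + (kv - q - 1 + d))" for i j
      using Fdeg_tact[OF Y_mem_Vg[OF m(1,2)] m(3), of "p - ku - d - i + j" "q + ku + d + i - j"]
      by (simp add: algebra_simps)
    then have "g \<in> Fdeg Vg (ku - p - 1 + (kv - q - 1 + d))"
      unfolding g by (intro Fdeg_diff Fdeg_sum Fdeg_scale Fdeg_tact m)
    then show ?thesis ..
  next
    case J
    then obtain u v ku kv p q i f d where g: "g = (\<lambda>x. \<Sum>j\<in>{0..ku + d}. of_nat (nat (ku + d) choose nat j) *
            tact (Y u (p - i - j) v) (q + i + j) f x)"
      and m: "u \<in> Vg ku" "v \<in> Vg kv" "f \<in> Fdeg Vg d" unfolding gensJ_def by blast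
    have "tact (Y u (p - i - j) v) (q + i + j) f \<in> Fdeg Vg (ku + kv + d - p - q - 2)" for j
      using Fdeg_tact[OF Y_mem_Vg[OF m(1,2)] m(3), of "p - i - j" "q + i + j"]
      by (simp add: algebra_simps)
    then have "g \<in> Fdeg Vg (ku + kv + d - p - q - 2)"
      unfolding g by (intro Fdeg_sum Fdeg_scale)
    then show ?thesis ..
  qed
qed

lemma K_fsupp: "f \<in> K \<Longrightarrow> fsupp f"
  unfolding K_def SM_kernel_def
proof (induction rule: tsubmod.induct)
  case (gen g)
  then consider "g \<in> mlin_rels sV sM" | "g \<in> gens1 Vg \<union> gens2 Vg \<rho> \<union> gens3 Y Vg \<union> gensJ Y Vg" by blast
  then show ?case
  proof cases
    case 1
    then show ?thesis unfolding mlin_rels_def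
      by (auto intro!: fsupp_diff fsupp_scale fsupp_sgl)
  next
    case 2
    then show ?thesis using homogeneous_generators Fdeg_fsupp by blast
  qed
qed (simp_all add: fsupp_zero fsupp_add fsupp_scale fsupp_tact)

section \<open>The grading of the quotient\<close>

text \<open>Elements of \<open>Fdeg\<close> are supported on words with homogeneous letters, so a
  word with a mixed letter is no member. Modulo \<open>K\<close> nothing is lost.\<close>

inductive_set homspan :: "(('v, 'm) word \<Rightarrow> complex) set" where
  homspan_base: "f \<in> Fdeg Vg d \<Longrightarrow> f \<in> homspan"
| homspan_add: "f \<in> homspan \<Longrightarrow> g \<in> homspan \<Longrightarrow> (\<lambda>x. f x + g x) \<in> homspan"

lemma homspan_fsupp: "f \<in> homspan \<Longrightarrow> fsupp f"
  by (induction rule: homspan.induct) (auto simp: Fdeg_fsupp fsupp_add)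

lemma homspan_sum: "(\<And>i. i \<in> I \<Longrightarrow> f i \<in> homspan) \<Longrightarrow> (\<lambda>x. \<Sum>i\<in>I. f i x) \<in> homspan"
  by (induction I rule: infinite_finite_induct)
    (simp_all add: homspan_base[OF Fdeg_zero] homspan_add)

lemma homspan_scale: "f \<in> homspan \<Longrightarrow> (\<lambda>x. c * f x) \<in> homspan"
  by (induction rule: homspan.induct)
    (auto simp: distrib_left intro: homspan_base Fdeg_scale homspan_add)

lemma homspan_tact: "f \<in> homspan \<Longrightarrow> u \<in> Vg k \<Longrightarrow> tact u m f \<in> homspan"
  by (induction rule: homspan.induct)
    (auto simp: tact_add intro: homspan_base Fdeg_tact homspan_add)

text \<open>By multilinearity each letter may be replaced by the sum of its components. Phrasing
  equality modulo \<open>K\<close> through annihilators lets the induction hypothesis act behind a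
  letter.\<close>

lemma homspan_word: "\<exists>h\<in>homspan. \<forall>l. annihilator K l \<longrightarrow> l (sgl (ls, w)) = l h"
proof (induction ls)
  case Nil
  have "sgl ([], w) \<in> homspan" by (rule homspan_base[of _ 0], rule Fdeg_sgl) (simp add: word_deg_Nil)
  then show ?case by blast
next
  case (Cons um ls)
  obtain u m where um: "um = (u, m)" by (cases um)
  obtain h where h: "h \<in> homspan" "\<forall>l. annihilator K l \<longrightarrow> l (sgl (ls, w)) = l h"
    using Cons by blast
  let ?h = "\<lambda>x. \<Sum>k\<in>{k. comp Vg u k \<noteq> 0}. tact (comp Vg u k) m h x"
  have "?h \<in> homspan" by (rule homspan_sum) (rule homspan_tact[OF h(1) comp_mem])
  moreover have "l (sgl (um # ls, w)) = l ?h" if l: "annihilator K l" for l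
  proof -
    have "l (sgl (um # ls, w)) = l (tact u m (sgl (ls, w)))" by (simp add: um tact_sgl)
    also have "\<dots> = l (tact u m h)" using h(2) annihilator_tact[OF l] by blast
    also have "\<dots> = l ?h"
      by (simp add: annihilator_linear[OF l] ann_letter_comp[OF l homspan_fsupp[OF h(1)], of u])
    finally show ?thesis .
  qed
  ultimately show ?case by blast
qed

lemma homspan_exists:
  assumes "fsupp f"
  shows "\<exists>h\<in>homspan. \<forall>l. annihilator K l \<longrightarrow> l f = l h"
proof -
  have "\<exists>h. h \<in> homspan \<and> (\<forall>l. annihilator K l \<longrightarrow> l (sgl b) = l h)" for b
    using homspan_word[of "fst b" "snd b"] unfolding prod.collapse by blast
  then have "\<forall>b. \<exists>h. h \<in> homspan \<and> (\<forall>l. annihilator K l \<longrightarrow> l (sgl b) = l h)" ..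
  from choice[OF this] obtain H where
    "\<forall>b. H b \<in> homspan \<and> (\<forall>l. annihilator K l \<longrightarrow> l (sgl b) = l (H b))" ..
  then have H: "\<And>b. H b \<in> homspan" "\<And>b l. annihilator K l \<Longrightarrow> l (sgl b) = l (H b)" by blast+
  let ?h = "\<lambda>x. \<Sum>b\<in>{b. f b \<noteq> 0}. f b * H b x"
  have "?h \<in> homspan" by (intro homspan_sum homspan_scale H)
  moreover have "l f = l ?h" if l: "annihilator K l" for l
    by (simp add: ann_fsupp[OF l assms] annihilator_linear[OF l] H(2)[OF l])
  ultimately show ?thesis by blast
qed

lemma homspan_decompose:
  assumes "h \<in> homspan"
  shows "\<exists>S g. finite S \<and> (\<forall>n. g n \<in> Fdeg Vg n) \<and> (\<forall>n. n \<notin> S \<longrightarrow> g n = (\<lambda>x. 0)) \<and> h = (\<lambda>x. \<Sum>n\<in>S. g n x)"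
  using assms
proof induction
  case (homspan_base f d)
  then show ?case
    by (intro exI[of _ "{d}"] exI[of _ "\<lambda>n. if n = d then f else (\<lambda>x. 0)"]) (auto simp: Fdeg_zero)
next
  case (homspan_add f1 f2)
  obtain S1 g1 where 1: "finite S1" "\<forall>n. g1 n \<in> Fdeg Vg n" "\<forall>n. n \<notin> S1 \<longrightarrow> g1 n = (\<lambda>x. 0)"
    "f1 = (\<lambda>x. \<Sum>n\<in>S1. g1 n x)" using homspan_add by blast
  obtain S2 g2 where 2: "finite S2" "\<forall>n. g2 n \<in> Fdeg Vg n" "\<forall>n. n \<notin> S2 \<longrightarrow> g2 n = (\<lambda>x. 0)"
    "f2 = (\<lambda>x. \<Sum>n\<in>S2. g2 n x)" using homspan_add by blast
  have "(\<Sum>n\<in>S1. g1 n x) = (\<Sum>n\<in>S1 \<union> S2. g1 n x)" "(\<Sum>n\<in>S2. g2 n x) = (\<Sum>n\<in>S1 \<union> S2. g2 n x)" for x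
    by (rule sum.mono_neutral_left; use 1 2 in auto)+
  then have "(\<lambda>x. f1 x + f2 x) = (\<lambda>x. \<Sum>n\<in>S1 \<union> S2. g1 n x + g2 n x)"
    by (simp add: 1(4) 2(4) sum.distrib)
  then show ?case using 1 2
    by (intro exI[of _ "S1 \<union> S2"] exI[of _ "\<lambda>n x. g1 n x + g2 n x"]) (auto simp: Fdeg_add)
qed

text \<open>Words without letters have degree 0, so a word of negative degree has a first letter,
  and \<open>gens1\<close> contains the result of applying this letter to the rest.\<close>

lemma K_negative_degree:
  assumes "f \<in> Fdeg Vg d" "d < 0"
  shows "f \<in> K"
proof (rule K_I)
  fix l assume l: "annihilator K l"
  have "l (sgl b) = 0" if deg: "word_deg Vg b d" for b
  proof -
    obtain ls w where b: "b = (ls, w)" by (cases b)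
    obtain u m ls' where ls: "ls = (u, m) # ls'"
      using deg assms(2) b by (cases ls) (auto simp: word_deg_Nil)
    obtain k where k: "u \<in> Vg k" "word_deg Vg (ls', w) (d - (k - m - 1))"
      using deg b ls by (auto simp: word_deg_Cons)
    have "tact u m (sgl (ls', w)) \<in> gens1 Vg"
      unfolding gens1_def using k(1) Fdeg_sgl[OF k(2)] assms(2) by force
    then have "tact u m (sgl (ls', w)) \<in> K" by (intro K_gen) blast
    then show ?thesis using annihilator_mem[OF l] b ls by (simp add: tact_sgl)
  qed
  then show "l f = 0"
    using assms(1) by (subst ann_fsupp[OF l Fdeg_fsupp[OF assms(1)]]) (auto simp: Fdeg_def intro!: sum.neutral)
qed

lemma ann_mode_neg:
  assumes "annihilator K l" "u \<in> Vg k" "f \<in> Fdeg Vg d" "k - m - 1 + d < 0"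
  shows "l (tact u m f) = 0"
  by (rule annihilator_mem[OF assms(1) K_negative_degree[OF Fdeg_tact[OF assms(2,3)] assms(4)]])

text \<open>The component of degree \<open>d\<close> of a word after all its letters have been split
  into homogeneous components.\<close>

fun word_part :: "int \<Rightarrow> ('v \<times> int) list \<Rightarrow> 'm \<Rightarrow> ('v, 'm) word \<Rightarrow> complex" where
  "word_part d [] w = (if d = 0 then sgl ([], w) else (\<lambda>x. 0))"
| "word_part d ((u, m) # ls) w =
     (\<lambda>x. \<Sum>k\<in>{k. comp Vg u k \<noteq> 0}. tact (comp Vg u k) m (word_part (d - (k - m - 1)) ls w) x)"

lemma word_part_fsupp: "fsupp (word_part d ls w)"
  by (induction d ls w rule: word_part.induct) (auto intro!: fsupp_sum simp: fsupp_sgl fsupp_zero fsupp_tact)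

lemma ann_word_part_homogeneous:
  assumes "annihilator K l" "word_deg Vg (ls, w) d"
  shows "l (word_part e ls w) = (if e = d then l (sgl (ls, w)) else 0)"
  using assms
proof (induction ls arbitrary: l d e)
  case Nil
  then show ?case by (auto simp: word_deg_Nil annihilator_zero)
next
  case (Cons um ls)
  obtain u m where um: "um = (u, m)" by (cases um)
  obtain k where k: "u \<in> Vg k" "word_deg Vg (ls, w) (d - (k - m - 1))"
    using Cons.prems(2) um by (auto simp: word_deg_Cons)
  show ?case
  proof (cases "u = 0")
    case True
    have "{k. comp Vg u k \<noteq> 0} = {}" using True comp_homogeneous[OF Vg_zero] by auto
    then show ?thesis
      using ann_letter_zero[OF Cons.prems(1) fsupp_sgl, of m "(ls, w)"] True
      by (simp add: um annihilator_zero[OF Cons.prems(1)] tact_sgl)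
  next
    case False
    have "{n. comp Vg u n \<noteq> 0} = {k}" using False comp_homogeneous[OF k(1)] by auto
    then have "l (word_part e (um # ls) w) = l (tact u m (word_part (e - (k - m - 1)) ls w))"
      using comp_homogeneous[OF k(1)] by (simp add: um)
    also have "\<dots> = (if e = d then l (tact u m (sgl (ls, w))) else 0)"
      using Cons.IH[OF annihilator_tact[OF Cons.prems(1)] k(2)] by simp
    finally show ?thesis by (simp add: um tact_sgl)
  qed
qed

lemma ann_word_part_letter:
  assumes "annihilator K l"
  shows "l (word_part d (ls @ (sV a u + sV b u', m) # ls') w)
    = a * l (word_part d (ls @ (u, m) # ls') w) + b * l (word_part d (ls @ (u', m) # ls') w)"
  using assms
proof (induction ls arbitrary: l d)
  case Nil
  note l = Nil
  let ?t = "\<lambda>u k. l (tact (comp Vg u k) m (word_part (d - (k - m - 1)) ls' w))"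
  \<comment> \<open>A common index set: the components of the combination are supported where those
    of \<open>u\<close> or of \<open>u'\<close> are.\<close>
  let ?F = "{k. comp Vg u k \<noteq> 0} \<union> {k. comp Vg u' k \<noteq> 0}"
  have F: "finite ?F" using comp_finite by blast
  have t: "l (word_part d ((v, m) # ls') w) = (\<Sum>k\<in>?F. ?t v k)" if "{k. comp Vg v k \<noteq> 0} \<subseteq> ?F" for v
    unfolding word_part.simps annihilator_sum[OF l]
    by (rule sum.mono_neutral_left[OF F that]) (auto simp: ann_letter_zero[OF l word_part_fsupp])
  have "{k. comp Vg (sV a u + sV b u') k \<noteq> 0} \<subseteq> ?F" by (auto simp: comp_linear)
  from t[OF this] t[of u] t[of u'] show ?case
    by (simp add: comp_linear ann_letter[OF l word_part_fsupp] sum.distrib sum_distrib_left del: word_part.simps)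
next
  case (Cons um ls)
  obtain v n where um: "um = (v, n)" by (cases um)
  show ?case
    by (simp add: um annihilator_sum[OF Cons.prems] Cons.IH[OF annihilator_tact[OF Cons.prems]]
        sum.distrib sum_distrib_left)
qed

lemma ann_word_part_vector:
  assumes "annihilator K l"
  shows "l (word_part d ls (sM a w + sM b w')) = a * l (word_part d ls w) + b * l (word_part d ls w')"
  using assms
proof (induction ls arbitrary: l d)
  case Nil
  have "(\<lambda>x. sgl ([], sM a w + sM b w') x - a * sgl ([], w) x - b * sgl ([], w') x) \<in> K"
    by (rule K_gen) (unfold mlin_rels_def, blast)
  from annihilator_mem[OF Nil this] show ?case
    by (simp add: annihilator_linear[OF Nil] algebra_simps)
next
  case (Cons um ls)
  obtain v n where um: "um = (v, n)" by (cases um)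
  show ?case
    by (simp add: um annihilator_sum[OF Cons.prems] Cons.IH[OF annihilator_tact[OF Cons.prems]]
        sum.distrib sum_distrib_left)
qed

text \<open>The functional \<open>l\<close> composed with the projection to degree \<open>d\<close>.
  On infinite support the sum is 0 by convention, so additivity is stated for finite
  support.\<close>

definition ann_part :: "((('v, 'm) word \<Rightarrow> complex) \<Rightarrow> complex) \<Rightarrow> int \<Rightarrow> (('v, 'm) word \<Rightarrow> complex) \<Rightarrow> complex" where
  "ann_part l d f = (\<Sum>b\<in>{b. f b \<noteq> 0}. f b * l (word_part d (fst b) (snd b)))"

lemma ann_part_superset:
  "finite F \<Longrightarrow> {b. f b \<noteq> 0} \<subseteq> F \<Longrightarrow> ann_part l d f = (\<Sum>b\<in>F. f b * l (word_part d (fst b) (snd b)))"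
  unfolding ann_part_def by (rule sum.mono_neutral_left) auto

lemma ann_part_add:
  assumes "fsupp f" "fsupp g"
  shows "ann_part l d (\<lambda>x. f x + g x) = ann_part l d f + ann_part l d g"
proof -
  let ?F = "{b. f b \<noteq> 0} \<union> {b. g b \<noteq> 0}"
  have F: "finite ?F" using assms by (simp add: fsupp_def)
  have "{b. f b + g b \<noteq> 0} \<subseteq> ?F" by auto
  then show ?thesis
    using ann_part_superset[OF F, of f l d] ann_part_superset[OF F, of g l d]
      ann_part_superset[OF F, of "\<lambda>x. f x + g x" l d]
    by (simp add: distrib_right sum.distrib)
qed

lemma ann_part_scale: "ann_part l d (\<lambda>x. c * f x) = c * ann_part l d f"
  by (cases "c = 0") (simp_all add: ann_part_def sum_distrib_left mult.assoc)

lemma ann_part_sgl: "ann_part l d (sgl b) = l (word_part d (fst b) (snd b))"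
  using ann_part_superset[of "{b}" "sgl b" l d] by (simp add: sgl_def subset_iff)

lemma ann_part_diff:
  assumes "fsupp f" "fsupp g"
  shows "ann_part l d (\<lambda>x. f x - g x) = ann_part l d f - ann_part l d g"
  using ann_part_add[OF assms(1) fsupp_scale[OF assms(2), of "-1"], of l d] ann_part_scale[of l d "-1" g] by simp

lemma ann_part_sum:
  "(\<And>i. i \<in> I \<Longrightarrow> fsupp (f i)) \<Longrightarrow> ann_part l d (\<lambda>x. \<Sum>i\<in>I. f i x) = (\<Sum>i\<in>I. ann_part l d (f i))"
  by (induction I rule: infinite_finite_induct)
    (simp_all add: ann_part_add fsupp_sum, simp_all add: ann_part_def)

lemma ann_part_tact:
  assumes l: "annihilator K l"
  shows "ann_part l d (tact u m f) = (\<Sum>k\<in>{k. comp Vg u k \<noteq> 0}.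
    ann_part (\<lambda>g. l (tact (comp Vg u k) m g)) (d - (k - m - 1)) f)"
proof -
  have inj: "inj_on (\<lambda>b. ((u, m) # fst b, snd b)) {b. f b \<noteq> 0}" by (auto simp: inj_on_def prod_eq_iff)
  have "ann_part l d (tact u m f) = (\<Sum>b\<in>{b. f b \<noteq> 0}. f b * l (word_part d ((u, m) # fst b) (snd b)))"
    unfolding ann_part_def supp_tact sum.reindex[OF inj] by (simp add: tact_Cons)
  also have "\<dots> = (\<Sum>k\<in>{k. comp Vg u k \<noteq> 0}. \<Sum>b\<in>{b. f b \<noteq> 0}.
      f b * l (tact (comp Vg u k) m (word_part (d - (k - m - 1)) (fst b) (snd b))))"
    by (subst sum.swap) (simp add: annihilator_sum[OF l] sum_distrib_left)
  finally show ?thesis by (simp add: ann_part_def)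
qed

lemma ann_part_homogeneous:
  assumes "annihilator K l" "f \<in> Fdeg Vg d"
  shows "ann_part l e f = (if e = d then l f else 0)"
proof -
  have "l (word_part e (fst b) (snd b)) = (if e = d then l (sgl b) else 0)" if "f b \<noteq> 0" for b
  proof -
    have "word_deg Vg (fst b, snd b) d"
      using that assms(2) unfolding Fdeg_def prod.collapse by blast
    from ann_word_part_homogeneous[OF assms(1) this] show ?thesis by simp
  qed
  then have "ann_part l e f = (\<Sum>b\<in>{b. f b \<noteq> 0}. f b * (if e = d then l (sgl b) else 0))"
    unfolding ann_part_def by (intro sum.cong refl) simp
  then show ?thesis using ann_fsupp[OF assms(1) Fdeg_fsupp[OF assms(2)]] by simp
qed

text \<open>Prefixing a letter changes both the functional and the degree, so \<open>l\<close> and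
  \<open>d\<close> stay arbitrary in the induction. Multilinearity is respected by
  \<open>word_part\<close>; on any other generator, being homogeneous, the projected value is 0 or
  that of \<open>l\<close>, which is 0 too.\<close>

lemma ann_part_K:
  assumes "f \<in> K" "annihilator K l"
  shows "ann_part l d f = 0"
  using assms unfolding K_def SM_kernel_def
proof (induction arbitrary: l d rule: tsubmod.induct)
  case (gen g)
  note l = gen(2)[folded SM_kernel_def K_def]
  consider (mlin) "g \<in> mlin_rels sV sM"
    | (hom) "g \<in> gens1 Vg \<union> gens2 Vg \<rho> \<union> gens3 Y Vg \<union> gensJ Y Vg" using gen(1) by blast
  then show ?case
  proof cases
    case mlin
    then show ?thesis unfolding mlin_rels_def
      by (auto simp: ann_part_diff ann_part_scale ann_part_sgl fsupp_diff fsupp_scale fsupp_sgl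
          ann_word_part_letter[OF l] ann_word_part_vector[OF l])
  next
    case hom
    then obtain e where "g \<in> Fdeg Vg e" using homogeneous_generators by blast
    moreover have "l g = 0" using annihilator_mem[OF l K_gen] gen(1) by blast
    ultimately show ?thesis by (simp add: ann_part_homogeneous[OF l])
  qed
next
  case zero
  then show ?case by (simp add: ann_part_def)
next
  case (add f g)
  have "fsupp f" "fsupp g" using add(1,2) by (auto intro: K_fsupp simp: K_def SM_kernel_def)
  then show ?case using add.IH(1)[OF add.prems] add.IH(2)[OF add.prems] by (simp add: ann_part_add)
next
  case (smul f c)
  show ?case using smul.IH[OF smul.prems] by (simp add: ann_part_scale)
next
  case (act f u m)
  note l = act.prems[folded SM_kernel_def K_def]
  show ?case unfolding ann_part_tact[OF l]
    using act.IH[OF annihilator_tact[OF l, unfolded SM_kernel_def K_def]] by simp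
qed

text \<open>The projection to degree \<open>m\<close> vanishes on the sum as an element of
  \<open>K\<close>, but it also picks out the value at \<open>g m\<close>.\<close>

lemma K_graded:
  assumes "finite S" "\<forall>n\<in>S. g n \<in> Fdeg Vg n" "(\<lambda>x. \<Sum>n\<in>S. g n x) \<in> K" "m \<in> S"
  shows "g m \<in> K"
proof (rule K_I)
  fix l assume l: "annihilator K l"
  have "0 = ann_part l m (\<lambda>x. \<Sum>n\<in>S. g n x)" by (simp add: ann_part_K[OF assms(3) l])
  also have "\<dots> = (\<Sum>n\<in>S. ann_part l m (g n))"
    by (rule ann_part_sum) (use assms(2) Fdeg_fsupp in blast)
  also have "\<dots> = (\<Sum>n\<in>S. if m = n then l (g n) else 0)"
    by (rule sum.cong) (use assms(2) in \<open>auto simp: ann_part_homogeneous[OF l]\<close>)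
  also have "\<dots> = l (g m)" using assms(1,4) by simp
  finally show "l (g m) = 0" by simp
qed

section \<open>Weak associativity in the quotient\<close>

lemma ann_iterate_zero:
  assumes l: "annihilator K l" and u: "u \<in> Vg ku" and v: "v \<in> Vg kv" and f: "f \<in> Fdeg Vg d"
    and m: "ku + kv \<le> m"
  shows "l (tact (Y u m v) n f) = 0"
proof -
  have "Y u m v \<in> {0}" using Y_mem_Vg[OF u v, of m] Vg_neg[of "ku + kv - m - 1"] m by simp
  then show ?thesis using ann_letter_zero[OF l Fdeg_fsupp[OF f]] by simp
qed

text \<open>The relations of \<open>gensJ\<close> with fixed total mode \<open>S\<close>, read as
  vanishing on \<open>z ^ (ku + d) * (z - 1) ^ m\<close>.\<close>

lemma ann_gensJ:
  assumes l: "annihilator K l" and u: "u \<in> Vg ku" and v: "v \<in> Vg kv" and f: "f \<in> Fdeg Vg d"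
    and nn: "0 \<le> ku" "0 \<le> d" and m: "m \<le> S - (ku + d) - (kv + d)"
  shows "wsum (bin (ku + d)) (\<lambda>n. l (tact (Y u n v) (S - n) f)) m = 0"
proof -
  define N where "N = nat (ku + d)"
  have N: "ku + d = int N" using nn by (simp add: N_def)
  \<comment> \<open>The relation is used with \<open>q = kv + d\<close> and
    \<open>i = Q - (kv + d)\<close>; its condition on \<open>i\<close> becomes
    \<open>0 \<le> i\<close>, which is the bound on \<open>m\<close>.\<close>
  define Q where "Q = S - int N - m"
  let ?g = "\<lambda>x. \<Sum>j\<in>{0..ku + d}. of_nat (nat (ku + d) choose nat j) *
            tact (Y u ((m + int N + (Q - (kv + d))) - (Q - (kv + d)) - j) v) ((kv + d) + (Q - (kv + d)) + j) f x"
  have "?g \<in> gensJ Y Vg" unfolding gensJ_def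
    by (rule CollectI, intro exI conjI, rule refl) (use u v f m N in \<open>auto simp: Q_def\<close>)
  then have "?g \<in> K" by (intro K_gen) blast
  then have "0 = l ?g" by (simp add: annihilator_mem[OF l])
  also have "\<dots> = (\<Sum>k\<le>N. of_nat (N choose k) * l (tact (Y u (m + int N - int k) v) (S - (m + int N - int k)) f))"
    unfolding N sum_atLeastAtMost_int_nat by (simp add: annihilator_linear[OF l] Q_def algebra_simps)
  also have "\<dots> = (\<Sum>j\<le>N. of_nat (N choose j) * l (tact (Y u (m + int j) v) (S - (m + int j)) f))"
    by (rule sum.reindex_bij_witness[of _ "\<lambda>k. N - k" "\<lambda>k. N - k"])
      (auto simp: of_nat_diff algebra_simps simp flip: binomial_symmetric)
  also have "\<dots> = wsum (bin (int N)) (\<lambda>n. l (tact (Y u n v) (S - n) f)) m"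
    by (rule wsum_bin_nat[symmetric, of "ku + kv"]) (use ann_iterate_zero[OF l u v f] in blast)
  finally show ?thesis by (simp add: N)
qed

text \<open>\<open>gens3\<close> applies when \<open>v(S - p) f\<close> and
  \<open>u(p) v(S - p) f\<close> have nonnegative degree; in the other cases both sides vanish for
  degree reasons, so the formula holds for all \<open>p\<close>.\<close>

lemma ann_gens3:
  assumes l: "annihilator K l" and u: "u \<in> Vg ku" and v: "v \<in> Vg kv" and f: "f \<in> Fdeg Vg d"
    and nn: "0 \<le> ku" "0 \<le> d"
  defines "c \<equiv> \<lambda>S n. l (tact (Y u n v) (S - n) f)"
  shows "l (tact u p (tact v (S - p) f))
    = wsum (bin (p - (ku + d))) (\<lambda>j. wsum (bin (ku + d)) (c S) (-j)) ((ku + d) - p)"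
proof -
  define N where "N = nat (ku + d)"
  have N: "ku + d = int N" using nn by (simp add: N_def)
  define q where "q = S - p"
  define h where "h = wsum (bin (ku + d)) (c S)"
  have h0: "h m = 0" if "m \<le> S - (ku + d) - (kv + d)" for m
    unfolding h_def c_def by (rule ann_gensJ[OF l u v f nn that])
  have vf: "tact v q f \<in> Fdeg Vg (kv - q - 1 + d)" by (rule Fdeg_tact[OF v f])
  \<comment> \<open>The upper limit in \<open>gens3\<close> is where \<open>gensJ\<close> takes
    over: all later values of \<open>h\<close> are 0, so the finite sum equals the full
    expansion.\<close>
  have rhs: "wsum (bin (p - (ku + d))) (\<lambda>j. h (-j)) ((ku + d) - p)
      = (\<Sum>i<nat (kv + d - q). bin (p - (ku + d)) i * h (p - (ku + d) - int i))"
    by (subst wsum_eq'[of _ "nat (kv + d - q)"]) (auto intro!: h0 simp: q_def algebra_simps split: if_splits)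
  consider (a) "kv + d \<le> q" | (b) "ku - p - 1 + (kv - q - 1 + d) < 0"
    | (c) "q < kv + d" "0 \<le> ku - p - 1 + kv - q - 1 + d" by linarith
  then have "l (tact u p (tact v q f)) = wsum (bin (p - (ku + d))) (\<lambda>j. h (-j)) ((ku + d) - p)"
  proof cases
    case a
    then have "l (tact u p (tact v q f)) = 0"
      by (intro annihilator_mem[OF l] K_tact K_negative_degree[OF vf]) simp
    then show ?thesis using a rhs by simp
  next
    case b
    have "c S n = 0" for n
      unfolding c_def by (rule ann_mode_neg[OF l Y_mem_Vg[OF u v] f]) (use b in \<open>simp add: q_def\<close>)
    then have "h m = 0" for m unfolding h_def by (intro wsum_zero) simp
    then show ?thesis using ann_mode_neg[OF l u vf b] rhs by simp
  next
    case c
    define n where "n = nat (kv + d - q)"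
    have n: "kv + d - q = int n" using c by (simp add: n_def)
    let ?s = "\<lambda>x. (\<Sum>i\<in>{0..kv + d - q - 1}. \<Sum>j\<in>{0..ku + d}.
            ((of_int (p - ku - d)) gchoose (nat i)) * of_nat (nat (ku + d) choose nat j) *
            tact (Y u (p - ku - d - i + j) v) (q + ku + d + i - j) f x)"
    have "(\<lambda>x. tact u p (tact v q f) x - ?s x) \<in> gens3 Y Vg"
      unfolding gens3_def using u v f c by blast
    then have "(\<lambda>x. tact u p (tact v q f) x - ?s x) \<in> K" by (intro K_gen) blast
    then have "l (tact u p (tact v q f)) = l ?s"
      using annihilator_mem[OF l] annihilator_diff[OF l] by fastforce
    also have "\<dots> = (\<Sum>i\<in>{0..kv + d - q - 1}. bin (p - (ku + d)) (nat i) *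
        (\<Sum>j\<in>{0..int N}. of_nat (N choose nat j) * c S (p - (ku + d) - i + j)))"
      using nn unfolding N[symmetric] N_def
      by (simp add: annihilator_linear[OF l] sum_distrib_left bin_def c_def q_def algebra_simps)
    also have "\<dots> = (\<Sum>i\<in>{0..kv + d - q - 1}. bin (p - (ku + d)) (nat i) * h (p - (ku + d) - i))"
    proof -
      have "(\<Sum>j\<in>{0..int N}. of_nat (N choose nat j) * c S (m + j)) = h m" for m
        unfolding sum_atLeastAtMost_int_nat h_def N
        by (subst wsum_bin_nat[of "ku + kv"]) (auto simp: c_def intro!: ann_iterate_zero[OF l u v f])
      then show ?thesis by simp
    qed
    also have "\<dots> = (\<Sum>i<n. bin (p - (ku + d)) i * h (p - (ku + d) - int i))"
      by (rule sum.reindex_bij_witness[of _ int nat]) (auto simp: n_def)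
    finally show ?thesis using rhs by (simp add: n_def)
  qed
  then show ?thesis by (simp add: q_def h_def)
qed

text \<open>Weak associativity in coefficients: from exponent \<open>ku + d\<close> on, the
  expansion at 1 paired with iterates agrees with the expansion at infinity paired with
  products.\<close>

lemma ann_associativity:
  assumes l: "annihilator K l" and u: "u \<in> Vg ku" and v: "v \<in> Vg kv" and f: "f \<in> Fdeg Vg d"
    and nn: "0 \<le> ku" "0 \<le> d" and p: "ku + d \<le> p"
  shows "wsum (bin p) (\<lambda>n. l (tact (Y u n v) (S - n) f)) r
    = wsum (altbin r) (\<lambda>j. l (tact u (-j) (tact v (S + j) f))) (- (p + r))"
proof -
  have "wsum (bin p) (\<lambda>n. l (tact (Y u n v) (S - n) f)) r
    = wsum (altbin r) (\<lambda>j. l (tact u (-j) (tact v (S - (-j)) f))) (- (p + r))"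
  proof (rule weak_associativity[where a = "\<lambda>p. l (tact u p (tact v (S - p) f))", OF _ _ _ p])
    show "\<forall>m\<ge>ku + kv. l (tact (Y u m v) (S - m) f) = 0"
      using ann_iterate_zero[OF l u v f] by blast
  qed (rule ann_gensJ[OF l u v f nn], assumption, rule ann_gens3[OF l u v f nn])
  then show ?thesis by simp
qed

section \<open>The vacuum\<close>

text \<open>With the vacuum as \<open>u\<close>, only the iterate of mode -1 survives, and the
  double sum of \<open>gens3\<close> becomes a Vandermonde convolution. The letter
  \<open>v(q)\<close> is there because \<open>gens3\<close> concerns two consecutive
  letters.\<close>

lemma ann_vac_tact:
  assumes l: "annihilator K l" and v: "v \<in> Vg kv" and g: "g \<in> Fdeg Vg d"
  shows "l (tact vac n (tact v q g)) = (if n = -1 then l (tact v q g) else 0)"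
proof (cases "d < 0")
  case True
  then have "g \<in> K" by (rule K_negative_degree[OF g])
  then show ?thesis using annihilator_mem[OF l] K_tact by simp
next
  case False
  define N where "N = nat d"
  have N: "d = int N" using False by (simp add: N_def)
  define S where "S = n + q"
  define z where "z = l (tact v (S + 1) g)"
  define c where "c m = l (tact (Y vac m v) (S - m) g)" for m
  have c: "c m = (if m = -1 then z else 0)" for m
    by (simp add: c_def vac_left z_def ann_letter_zero[OF l Fdeg_fsupp[OF g]])
  define h where "h = wsum (bin d) c"
  have h: "h m = (if m \<le> -1 then bin d (nat (-1 - m)) * z else 0)" for m
  proof (cases "m \<le> -1")
    case True
    then show ?thesis unfolding h_def by (subst wsum_single[of _ "nat (-1 - m)"]) (auto simp: c)
  next
    case False
    then show ?thesis unfolding h_def by (subst wsum_zero) (auto simp: c)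
  qed
  have "l (tact vac n (tact v (S - n) g)) = wsum (bin (n - d)) (\<lambda>j. h (-j)) (d - n)"
    using ann_gens3[OF l vac_mem v g, of n S] False unfolding h_def c_def[abs_def] by simp
  \<comment> \<open>From \<open>i = n + 2\<close> on, the lower index in \<open>h\<close> exceeds
    \<open>d\<close>, so the binomial coefficient is 0.\<close>
  also have "\<dots> = (\<Sum>i<nat (n + 2). bin (n - d) i * h (- (d - n + int i)))"
  proof (rule wsum_eq)
    show "\<forall>j\<ge>- (S - d - (kv + d)). h (-j) = 0"
      unfolding h_def c_def[abs_def] using ann_gensJ[OF l vac_mem v g, of _ S] False by simp
    fix i assume "nat (n + 2) \<le> i"
    then have "N < nat (-1 - (- (d - n + int i)))" by (simp add: N)
    then show "bin (n - d) i * h (- (d - n + int i)) = 0" by (simp add: h N bin_of_nat)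
  qed
  also have "\<dots> = (if n = -1 then z else 0)"
  proof (cases "n < -1")
    case False
    define t where "t = nat (n + 1)"
    have n: "n = int t - 1" using False by (simp add: t_def)
    have "h (- (d - n + int i)) = bin d (t - i) * z" if "i \<le> t" for i
    proof (cases "t - i \<le> N")
      case True
      then have "nat (-1 - (- (d - n + int i))) = N - (t - i)" "- (d - n + int i) \<le> -1"
        using that by (auto simp: N n of_nat_diff)
      then show ?thesis using True by (simp add: h N bin_of_nat flip: binomial_symmetric)
    next
      case False
      then have "\<not> - (d - n + int i) \<le> -1" using that by (auto simp: N n of_nat_diff)
      then show ?thesis using False by (simp add: h N bin_of_nat binomial_eq_0)
    qed
    moreover have "nat (n + 2) = Suc t" by (simp add: n)
    ultimately have "(\<Sum>i<nat (n + 2). bin (n - d) i * h (- (d - n + int i)))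
        = (\<Sum>i\<le>t. bin (n - d) i * bin d (t - i)) * z"
      by (simp add: lessThan_Suc_atMost sum_distrib_right mult.assoc)
    also have "\<dots> = bin n t * z" by (simp add: bin_Vandermonde)
    \<comment> \<open>Since \<open>n = t - 1\<close>, the coefficient is 1 for \<open>t = 0\<close>
      and 0 for all larger \<open>t\<close>.\<close>
    also have "\<dots> = (if n = -1 then z else 0)"
    proof (cases t)
      case (Suc k)
      then have "bin n t = bin (int k) (Suc k)" by (simp add: n)
      then show ?thesis by (simp add: bin_of_nat n Suc)
    qed (simp add: n)
    finally show ?thesis .
  qed simp
  finally show ?thesis by (simp add: S_def z_def)
qed

lemma ann_vac_Nil:
  assumes l: "annihilator K l"
  shows "l (tact vac (-1) (sgl ([], w))) = l (sgl ([], w))"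
proof -
  have "\<rho> vac = id" using zr by (simp add: zhu_rep_def)
  moreover have "(\<lambda>x. o_t Vg vac w x - sgl ([], \<rho> vac w) x) \<in> K"
    by (rule K_gen) (unfold gens2_def, blast)
  ultimately have *: "l (o_t Vg vac w) = l (sgl ([], w))"
    using annihilator_mem[OF l] annihilator_diff[OF l] by fastforce
  \<comment> \<open>If the vacuum is zero, the index set in \<open>o_t\<close> is empty; otherwise
    it is \<open>{0}\<close>, because the vacuum has weight 0.\<close>
  show ?thesis
  proof (cases "vac = 0")
    case True
    then have "o_t Vg vac w = (\<lambda>x. 0)" using comp_homogeneous[OF vac_mem] by (simp add: o_t_def)
    then show ?thesis using * True ann_letter_zero[OF l fsupp_sgl] by (simp add: annihilator_zero[OF l])
  next
    case False
    then have "{k. comp Vg vac k \<noteq> 0} = {0}" using comp_homogeneous[OF vac_mem] by auto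
    then have "o_t Vg vac w = sgl ([(vac, -1)], w)"
      using comp_homogeneous[OF vac_mem] by (simp add: o_t_def)
    then show ?thesis using * by (simp add: tact_sgl)
  qed
qed

lemma ann_vac:
  assumes l: "annihilator K l" and f: "fsupp f"
  shows "l (tact vac n f) = (if n = -1 then l f else 0)"
proof -
  have nil: "l (tact vac n (sgl ([], w))) = (if n = -1 then l (sgl ([], w)) else 0)" for w
  proof -
    have mem: "sgl ([], w) \<in> Fdeg Vg 0" by (rule Fdeg_sgl) (simp add: word_deg_Nil)
    \<comment> \<open>Mode -1 of the vacuum acts as the identity on \<open>M\<close>, so inserting
      it supplies the second letter that the previous case requires.\<close>
    have "l (tact vac n (tact vac (-1) (sgl ([], w)))) = (if n = -1 then l (sgl ([], w)) else 0)"
      unfolding ann_vac_tact[OF l vac_mem mem] ann_vac_Nil[OF l] ..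
    then show ?thesis unfolding ann_vac_Nil[OF annihilator_tact[OF l]] .
  qed
  have word: "l (tact vac n (sgl b)) = (if n = -1 then l (sgl b) else 0)" if "word_deg Vg b d" for b d
  proof -
    obtain ls w where b: "b = (ls, w)" by (cases b)
    show ?thesis
    proof (cases ls)
      case Nil
      then show ?thesis using nil b by simp
    next
      case (Cons vq ls')
      obtain v q where vq: "vq = (v, q)" by (cases vq)
      obtain k where k: "v \<in> Vg k" "word_deg Vg (ls', w) (d - (k - q - 1))"
        using \<open>word_deg Vg b d\<close> b Cons vq by (auto simp: word_deg_Cons)
      show ?thesis using ann_vac_tact[OF l k(1) Fdeg_sgl[OF k(2)], of n q] by (simp add: b Cons vq tact_sgl)
    qed
  qed
  have hom: "l (tact vac n h) = (if n = -1 then l h else 0)" if "h \<in> homspan" for h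
    using that
  proof induction
    case (homspan_base h d)
    have deg: "word_deg Vg b d" if "h b \<noteq> 0" for b using that homspan_base unfolding Fdeg_def by blast
    note fs = Fdeg_fsupp[OF homspan_base]
    have "l (tact vac n h) = (\<Sum>b\<in>{b. h b \<noteq> 0}. h b * (if n = -1 then l (sgl b) else 0))"
      unfolding ann_fsupp[OF annihilator_tact[OF l] fs]
      by (rule sum.cong[OF refl]) (rule arg_cong[OF word[OF deg]], simp)
    then show ?case by (simp add: ann_fsupp[OF l fs])
  next
    case (homspan_add f g)
    then show ?case by (simp add: tact_add annihilator_add[OF l])
  qed
  obtain h where h: "h \<in> homspan" "\<forall>l. annihilator K l \<longrightarrow> l f = l h"
    using homspan_exists[OF f] by blast
  then have "l f = l h" "l (tact vac n f) = l (tact vac n h)" using l annihilator_tact[OF l] by blast+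
  then show ?thesis using hom[OF h(1)] by simp
qed

section \<open>Skew symmetry and the Jacobi identity\<close>

text \<open>The modes of a divided power of translation. Associativity with the vacuum at
  \<open>r = - int k - 1\<close> expresses a combination of the \<open>c (- int k' - 1)\<close> with
  \<open>k' \<le> k\<close>, where \<open>k' = k\<close> has coefficient 1, through
  \<open>c (-1)\<close>. Strong induction and Vandermonde then determine
  \<open>c (- int k - 1)\<close>.\<close>

lemma ann_vac_derivative:
  assumes l: "annihilator K l" and a: "a \<in> Vg ka" and f: "f \<in> Fdeg Vg d"
  shows "l (tact (Y a (- int k - 1) vac) m f) = bin (int k - m - 1) k * l (tact a (m - int k) f)"
proof -
  consider (d) "d < 0" | (k) "ka < 0" | (n) "0 \<le> ka" "0 \<le> d" by linarith
  then show ?thesis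
  proof cases
    case d
    then have "f \<in> K" by (rule K_negative_degree[OF f])
    then show ?thesis using annihilator_mem[OF l] K_tact by simp
  next
    case k
    then have "a = 0" using a Vg_neg by auto
    then show ?thesis by (simp add: Y_left ann_letter_zero[OF l Fdeg_fsupp[OF f]])
  next
    case n
    define S where "S = m - int k - 1"
    define c where "c j = l (tact (Y a j vac) (S - j) f)" for j
    have c1: "c (-1) = l (tact a (S + 1) f)" by (simp add: c_def vac_right)
    have c0: "c j = 0" if "0 \<le> j" for j
      using that by (simp add: c_def vac_right ann_letter_zero[OF l Fdeg_fsupp[OF f]])
    have "c (- int k - 1) = bin (- S - 2) k * c (-1)" for k
    proof (induction k rule: less_induct)
      case (less k)
      \<comment> \<open>The first entry makes associativity applicable; the second makes
        \<open>i\<close> nonnegative, which is the index of the only term where the vacuum has mode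
        -1.\<close>
      define p where "p = max (ka + d) (int k + S + 2)"
      define i where "i = nat (p - int k - S - 2)"
      have "0 \<le> p - int k - S - 2" by (simp add: p_def)
      then have i: "int i = p - int k - S - 2" by (simp add: i_def)
      have "wsum (bin p) c (- int k - 1)
          = wsum (altbin (- int k - 1)) (\<lambda>j. l (tact a (-j) (tact vac (S + j) f))) (- (p + (- int k - 1)))"
        unfolding c_def[abs_def] by (rule ann_associativity[OF l a vac_mem f n]) (simp add: p_def)
      also have "(\<lambda>j. l (tact a (-j) (tact vac (S + j) f))) = (\<lambda>j. if j = -1 - S then c (-1) else 0)"
        using ann_vac[OF annihilator_tact[OF l] Fdeg_fsupp[OF f]] by (auto simp: c1 fun_eq_iff)
      also have "wsum (altbin (- int k - 1)) \<dots> (- (p + (- int k - 1))) = altbin (- int k - 1) i * c (-1)"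
        by (subst wsum_single[of _ i]) (auto simp: i)
      also have "altbin (- int k - 1) i = bin (int (i + k)) i"
        using bin_negated[of "- int k - 1" i] by (simp add: altbin_def algebra_simps flip: power_mult_distrib mult.assoc)
      also have "\<dots> = bin (int (i + k)) k"
        unfolding bin_of_nat using binomial_symmetric[of i "i + k"] by simp
      also have "int (i + k) = p + (- S - 2)" by (simp add: i)
      also have "bin (p + (- S - 2)) k = (\<Sum>i\<le>k. bin p i * bin (- S - 2) (k - i))"
        by (rule bin_Vandermonde[symmetric])
      also have "\<dots> = bin (- S - 2) k + (\<Sum>i<k. bin p (Suc i) * bin (- S - 2) (k - Suc i))"
        by (cases k) (simp_all add: sum.atMost_shift)
      finally have 1: "wsum (bin p) c (- int k - 1)
          = (bin (- S - 2) k + (\<Sum>i<k. bin p (Suc i) * bin (- S - 2) (k - Suc i))) * c (-1)" .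
      have "wsum (bin p) c (- int k - 1) = (\<Sum>i<Suc k. bin p i * c (- int k - 1 + int i))"
        by (rule wsum_eq') (simp add: c0)
      also have "\<dots> = c (- int k - 1) + (\<Sum>i<k. bin p (Suc i) * c (- int (k - Suc i) - 1))"
        unfolding sum.lessThan_Suc_shift by (simp add: of_nat_diff algebra_simps)
      also have "(\<Sum>i<k. bin p (Suc i) * c (- int (k - Suc i) - 1))
          = (\<Sum>i<k. bin p (Suc i) * bin (- S - 2) (k - Suc i)) * c (-1)"
        unfolding sum_distrib_right mult.assoc
        by (intro sum.cong refl arg_cong2[where f = "(*)"] less.IH) auto
      finally show ?case using 1 by (simp add: distrib_right)
    qed
    from this[of k] show ?thesis
      unfolding c1 by (simp add: c_def S_def algebra_simps)
  qed
qed

text \<open>Skew symmetry of \<open>V\<close>, with divided powers of translation turned into mode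
  shifts. The sign from \<open>bin_negated\<close> cancels the alternating sign of the sum.\<close>

lemma ann_skew_symmetry:
  assumes l: "annihilator K l" and u: "u \<in> Vg ku" and v: "v \<in> Vg kv" and f: "f \<in> Fdeg Vg d"
  shows "l (tact (Y v n u) (S - n) f)
    = - ((-1) powi n * wsum (bin (S - n)) (\<lambda>j. l (tact (Y u j v) (S - j) f)) n)"
proof -
  define c where "c j = l (tact (Y u j v) (S - j) f)" for j
  have fs: "fsupp f" by (rule Fdeg_fsupp[OF f])
  obtain M where M: "\<forall>k\<ge>M. (\<Sum>i\<le>k. sV ((-1) ^ i) (Y (Y u (n + int i) v) (-1 - int i) vac))
    = - sV ((-1) powi n) (Y v n u)" using skew_symmetry by blast
  define k where "k = max M (nat (ku + kv - n))"
  have "l (tact (\<Sum>i\<le>k. sV ((-1) ^ i) (Y (Y u (n + int i) v) (-1 - int i) vac)) (S - n) f)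
      = (\<Sum>i\<le>k. bin (S - n) i * c (n + int i))"
  proof -
    have minus: "-1 - int i = - int i - 1" for i by simp
    have "l (tact (Y (Y u (n + int i) v) (-1 - int i) vac) (S - n) f)
        = bin (int i - (S - n) - 1) i * c (n + int i)" for i
      unfolding minus using ann_vac_derivative[OF l Y_mem_Vg[OF u v] f, of "n + int i" i "S - n"]
      by (simp add: c_def algebra_simps)
    then show ?thesis
      by (simp add: ann_letter_sum[OF l fs] ann_letter_scale[OF l fs] bin_negated[of "S - n"] mult.assoc)
  qed
  also have "\<dots> = wsum (bin (S - n)) c n"
    unfolding lessThan_Suc_atMost[symmetric]
    by (rule wsum_eq'[symmetric]) (use ann_iterate_zero[OF l u v f] in \<open>auto simp: c_def k_def\<close>)
  finally have "- ((-1) powi n * l (tact (Y v n u) (S - n) f)) = wsum (bin (S - n)) c n"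
    using M by (simp add: k_def ann_letter_uminus[OF l fs] ann_letter_scale[OF l fs])
  then have "- ((-1) powi n * wsum (bin (S - n)) c n)
      = ((-1) powi n * (-1) powi n) * l (tact (Y v n u) (S - n) f)"
    by (metis mult.assoc mult_minus_right minus_minus)
  also have "(-1) powi n * (-1) powi n = (1 :: complex)"
    by (simp flip: power_int_mult_distrib)
  finally show ?thesis unfolding c_def[abs_def] by simp
qed

lemma ann_jacobi:
  assumes l: "annihilator K l" and u: "u \<in> Vg ku" and v: "v \<in> Vg kv" and f: "f \<in> Fdeg Vg d"
    and nn: "0 \<le> ku" "0 \<le> kv" "0 \<le> d"
  shows "wsum (bin p) (\<lambda>n. l (tact (Y u n v) (S - n) f)) r
    = wsum (altbin r) (\<lambda>j. l (tact u (-j) (tact v (S + j) f))) (- (p + r))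
      - (-1) powi r * wsum (altbin r) (\<lambda>p. l (tact v (S - p) (tact u p f))) p"
proof -
  define c where "c n = l (tact (Y u n v) (S - n) f)" for n
  define a where "a p = l (tact u p (tact v (S - p) f))" for p
  define b where "b p = l (tact v (S - p) (tact u p f))" for p
  have c0: "\<forall>m\<ge>ku + kv. c m = 0" unfolding c_def using ann_iterate_zero[OF l u v f] by blast
  have a0: "a p = 0" if "p \<le> S - (kv + d)" for p
    unfolding a_def by (rule ann_mode_neg[OF annihilator_tact[OF l] v f]) (use that in simp)
  have b0: "\<forall>p\<ge>ku + d. b p = 0"
    unfolding b_def using ann_mode_neg[OF annihilator_tact[OF l] u f] by simp
  have sq: "(-1) powi r * ((-1) powi r * x) = x" for r and x :: complex
    by (simp flip: mult.assoc power_int_mult_distrib)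
  have "wsum (bin p) c r = wsum (altbin r) (\<lambda>j. a (-j)) (- (p + r)) - (-1) powi r * wsum (altbin r) b p"
  proof (rule jacobi_from_two_associativities[OF a0 b0 c0])
    show "wsum (bin p) c r = wsum (altbin r) (\<lambda>j. a (-j)) (- (p + r))" if "ku + d \<le> p" for p r
      using ann_associativity[OF l u v f nn(1,3) that, of S r] by (simp add: c_def[abs_def] a_def)
    show "wsum (bin p) c r = - ((-1) powi r * wsum (altbin r) b p)" if "p + r \<le> S - (kv + d)" for p r
    proof -
      \<comment> \<open>The exponent of \<open>z\<close> after substituting \<open>1/z\<close> in
        \<open>z ^ p * (z - 1) ^ r\<close>, shifted by \<open>S\<close>. The assumption on
        \<open>p + r\<close> becomes \<open>kv + d \<le> q\<close>, as associativity for the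
        exchanged pair requires.\<close>
      define q where "q = S - r - p"
      have "wsum (altbin r) b p = wsum (altbin r) (\<lambda>j. b (j + S)) (- (q + r))"
        unfolding wsum_shift by (simp add: q_def)
      also have "\<dots> = wsum (bin q) (\<lambda>n. l (tact (Y v n u) (S - n) f)) r"
        using ann_associativity[OF l v u f nn(2,3), of q S r] that by (simp add: b_def q_def add.commute)
      also have "\<dots> = wsum (bin q) (\<lambda>n. - ((-1) powi n * wsum (bin (S - n)) c n)) r"
        unfolding ann_skew_symmetry[OF l u v f] c_def[abs_def] ..
      also have "\<dots> = - ((-1) powi r * wsum (altbin q) (\<lambda>n. wsum (bin (S - n)) c n) r)"
        by (rule wsum_alternate)
      also have "wsum (altbin q) (\<lambda>n. wsum (bin (S - n)) c n) r = wsum (bin p) c r"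
        using wsum_altbin_bin[OF c0, of q S r] by (simp add: q_def)
      finally show ?thesis using sq[of r "wsum (bin p) c r"] by simp
    qed
  qed
  then show ?thesis by (simp add: c_def[abs_def] a_def b_def[abs_def])
qed

section \<open>The Jacobi identity modulo the kernel, from homogeneous to arbitrary
  arguments\<close>

definition jacobi_defect :: "int \<Rightarrow> int \<Rightarrow> int \<Rightarrow> 'v \<Rightarrow> 'v \<Rightarrow> (('v, 'm) word \<Rightarrow> complex) \<Rightarrow> nat \<Rightarrow> ('v, 'm) word \<Rightarrow> complex" where
  "jacobi_defect p q r u v f n = 
     (\<lambda>x. (\<Sum>i\<le>n. ((of_int p) gchoose i) * tact (Y u (r + int i) v) (p + q - int i) f x)
            - (\<Sum>i\<le>n. (-1) ^ i * ((of_int r) gchoose i) *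
                 (tact u (p + r - int i) (tact v (q + int i) f) x
                  - (-1) powi r * tact v (q + r - int i) (tact u (p + int i) f) x)))"

lemma ann_jacobi_defect:
  assumes l: "annihilator K l"
  shows "l (jacobi_defect p q r u v f n) =
    (\<Sum>i\<le>n. bin p i * l (tact (Y u (r + int i) v) (p + q - int i) f))
    - ((\<Sum>i\<le>n. altbin r i * l (tact u (p + r - int i) (tact v (q + int i) f)))
      - (-1) powi r * (\<Sum>i\<le>n. altbin r i * l (tact v (q + r - int i) (tact u (p + int i) f))))"
  by (simp add: jacobi_defect_def annihilator_linear[OF l] altbin_def bin_def right_diff_distrib
      sum_subtractf sum_distrib_left mult_ac)

definition jacobi :: "int \<Rightarrow> int \<Rightarrow> int \<Rightarrow> 'v \<Rightarrow> 'v \<Rightarrow> (('v, 'm) word \<Rightarrow> complex) \<Rightarrow> bool" where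
  "jacobi p q r u v f \<longleftrightarrow> (\<exists>N. \<forall>n\<ge>N. jacobi_defect p q r u v f n \<in> K)"

lemma jacobi_trivial:
  assumes "\<And>l n. annihilator K l \<Longrightarrow> l (jacobi_defect p q r u v f n) = 0"
  shows "jacobi p q r u v f"
  unfolding jacobi_def by (intro exI allI impI K_I) (rule assms)

lemma jacobi_zero_left:
  assumes "fsupp f"
  shows "jacobi p q r 0 v f"
proof (rule jacobi_trivial)
  fix l n assume l: "annihilator K l"
  show "l (jacobi_defect p q r 0 v f n) = 0"
    by (simp add: ann_jacobi_defect[OF l] Y_left ann_letter_zero[OF l] fsupp_tact assms
        ann_letter_zero[OF annihilator_tact[OF l]])
qed

lemma jacobi_zero_right:
  assumes "fsupp f"
  shows "jacobi p q r u 0 f"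
proof (rule jacobi_trivial)
  fix l n assume l: "annihilator K l"
  show "l (jacobi_defect p q r u 0 f n) = 0"
    by (simp add: ann_jacobi_defect[OF l] Y_right ann_letter_zero[OF l] fsupp_tact assms
        ann_letter_zero[OF annihilator_tact[OF l]])
qed

lemma jacobi_K:
  assumes "f \<in> K"
  shows "jacobi p q r u v f"
proof (rule jacobi_trivial)
  fix l n assume l: "annihilator K l"
  show "l (jacobi_defect p q r u v f n) = 0"
    by (simp add: ann_jacobi_defect[OF l] annihilator_mem[OF l] K_tact assms)
qed

lemma jacobi_homogeneous:
  assumes u: "u \<in> Vg ku" and v: "v \<in> Vg kv" and f: "f \<in> Fdeg Vg d"
  shows "jacobi p q r u v f"
proof -
  consider "f \<in> K" | "u = 0" | "v = 0" | (n) "0 \<le> ku" "0 \<le> kv" "0 \<le> d"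
    using Vg_neg[of ku] Vg_neg[of kv] K_negative_degree[OF f] u v by fastforce
  then show ?thesis
  proof cases
    case 1
    then show ?thesis by (rule jacobi_K)
  next
    case 2
    then show ?thesis using jacobi_zero_left[OF Fdeg_fsupp[OF f]] by simp
  next
    case 3
    then show ?thesis using jacobi_zero_right[OF Fdeg_fsupp[OF f]] by simp
  next
    case n
    define S where "S = p + q + r"
    \<comment> \<open>One summand for each of the three sums in the identity: beyond it,
      \<open>Y u (r + int i) v\<close>, \<open>v(q + i) f\<close> and \<open>u(p + i) f\<close>
      respectively have negative weight or degree.\<close>
    define M where "M = nat (ku + kv - r) + nat (kv + d - q) + nat (ku + d - p)"
    have "jacobi_defect p q r u v f n \<in> K" if "M \<le> n" for n
    proof (rule K_I)
      fix l assume l: "annihilator K l"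
      have 1: "wsum (bin p) (\<lambda>n. l (tact (Y u n v) (S - n) f)) r
        = (\<Sum>i\<le>n. bin p i * l (tact (Y u (r + int i) v) (p + q - int i) f))"
        unfolding lessThan_Suc_atMost[symmetric]
        by (subst wsum_eq'[of _ "Suc n"])
          (use that in \<open>auto simp: M_def S_def algebra_simps intro!: ann_iterate_zero[OF l u v f]\<close>)
      have 2: "wsum (altbin r) (\<lambda>j. l (tact u (-j) (tact v (S + j) f))) (- (p + r))
        = (\<Sum>i\<le>n. altbin r i * l (tact u (p + r - int i) (tact v (q + int i) f)))"
        unfolding lessThan_Suc_atMost[symmetric]
        by (subst wsum_eq'[of _ "Suc n"])
          (use that in \<open>auto simp: M_def S_def algebra_simps intro!: ann_mode_neg[OF annihilator_tact[OF l] v f]\<close>)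
      have 3: "wsum (altbin r) (\<lambda>p. l (tact v (S - p) (tact u p f))) p
        = (\<Sum>i\<le>n. altbin r i * l (tact v (q + r - int i) (tact u (p + int i) f)))"
        unfolding lessThan_Suc_atMost[symmetric]
        by (subst wsum_eq'[of _ "Suc n"])
          (use that in \<open>auto simp: M_def S_def algebra_simps intro!: ann_mode_neg[OF annihilator_tact[OF l] u f]\<close>)
      show "l (jacobi_defect p q r u v f n) = 0"
        using ann_jacobi[OF l u v f n, of p S r] unfolding 1 2 3 by (simp add: ann_jacobi_defect[OF l])
    qed
    then show ?thesis unfolding jacobi_def by blast
  qed
qed

text \<open>The bound on \<open>n\<close> must not depend on \<open>l\<close>, so the two bounds are
  merged before functionals are applied.\<close>

lemma jacobi_combine:
  assumes "jacobi p q r u1 v1 f1" "jacobi p q r u2 v2 f2"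
    and "\<And>n l. annihilator K l \<Longrightarrow> l (jacobi_defect p q r u v f n)
        = l (jacobi_defect p q r u1 v1 f1 n) + l (jacobi_defect p q r u2 v2 f2 n)"
  shows "jacobi p q r u v f"
proof -
  obtain N1 N2 where N: "\<forall>n\<ge>N1. jacobi_defect p q r u1 v1 f1 n \<in> K" "\<forall>n\<ge>N2. jacobi_defect p q r u2 v2 f2 n \<in> K"
    using assms(1,2) by (auto simp: jacobi_def)
  have "jacobi_defect p q r u v f n \<in> K" if "max N1 N2 \<le> n" for n
  proof (rule K_I)
    fix l assume l: "annihilator K l"
    show "l (jacobi_defect p q r u v f n) = 0"
      unfolding assms(3)[OF l] using N that by (simp add: annihilator_mem[OF l])
  qed
  then show ?thesis unfolding jacobi_def by blast
qed

lemma jacobi_add_left: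
  assumes "fsupp f" "jacobi p q r u1 v f" "jacobi p q r u2 v f"
  shows "jacobi p q r (u1 + u2) v f"
proof (rule jacobi_combine[OF assms(2,3)])
  fix n l assume l: "annihilator K l"
  show "l (jacobi_defect p q r (u1 + u2) v f n) = l (jacobi_defect p q r u1 v f n) + l (jacobi_defect p q r u2 v f n)"
    by (simp add: ann_jacobi_defect[OF l] Y_left ann_letter_add[OF l] fsupp_tact assms(1)
        ann_letter_add[OF annihilator_tact[OF l]] sum.distrib algebra_simps)
qed

lemma jacobi_add_right:
  assumes "fsupp f" "jacobi p q r u v1 f" "jacobi p q r u v2 f"
  shows "jacobi p q r u (v1 + v2) f"
proof (rule jacobi_combine[OF assms(2,3)])
  fix n l assume l: "annihilator K l"
  show "l (jacobi_defect p q r u (v1 + v2) f n) = l (jacobi_defect p q r u v1 f n) + l (jacobi_defect p q r u v2 f n)"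
    by (simp add: ann_jacobi_defect[OF l] Y_right ann_letter_add[OF l] fsupp_tact assms(1)
        ann_letter_add[OF annihilator_tact[OF l]] sum.distrib algebra_simps)
qed

text \<open>The arguments are freed from homogeneity one at a time: first \<open>u\<close>, then
  \<open>v\<close>, and finally \<open>f\<close> through a representative in
  \<open>homspan\<close>.\<close>

lemma jacobi_fsupp:
  assumes "fsupp f"
  shows "jacobi p q r u v f"
proof -
  have left: "jacobi p q r u v g" if v: "v \<in> Vg kv" and g: "g \<in> Fdeg Vg d" for u v kv g d
  proof -
    have "jacobi p q r (\<Sum>k\<in>F. comp Vg u k) v g" for F
      by (induction F rule: infinite_finite_induct)
        (simp_all add: jacobi_zero_left jacobi_add_left jacobi_homogeneous[OF comp_mem v g] Fdeg_fsupp[OF g])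
    then show ?thesis using comp_sum[of u] by metis
  qed
  have right: "jacobi p q r u v g" if g: "g \<in> Fdeg Vg d" for u v g d
  proof -
    have "jacobi p q r u (\<Sum>k\<in>F. comp Vg v k) g" for F
      by (induction F rule: infinite_finite_induct)
        (simp_all add: jacobi_zero_right jacobi_add_right left[OF comp_mem g] Fdeg_fsupp[OF g])
    then show ?thesis using comp_sum[of v] by metis
  qed
  have hom: "jacobi p q r u v h" if "h \<in> homspan" for h
    using that
  proof induction
    case (homspan_base g d)
    then show ?case by (rule right)
  next
    case (homspan_add g1 g2)
    show ?case
    proof (rule jacobi_combine[OF homspan_add.IH])
      fix n l assume l: "annihilator K l"
      show "l (jacobi_defect p q r u v (\<lambda>x. g1 x + g2 x) n)
          = l (jacobi_defect p q r u v g1 n) + l (jacobi_defect p q r u v g2 n)"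
        by (simp add: ann_jacobi_defect[OF l] tact_add annihilator_add[OF l] sum.distrib algebra_simps)
    qed
  qed
  obtain h where h: "h \<in> homspan" "\<forall>l. annihilator K l \<longrightarrow> l f = l h"
    using homspan_exists[OF assms] by blast
  have "l (jacobi_defect p q r u v f n) = l (jacobi_defect p q r u v h n)" if l: "annihilator K l" for l n
  proof -
    have "l (tact u m f) = l (tact u m h)" "l (tact u m (tact u' m' f)) = l (tact u m (tact u' m' h))" for u m u' m'
      using h(2) annihilator_tact[OF l] annihilator_tact[OF annihilator_tact[OF l]] by blast+
    then show ?thesis by (simp add: ann_jacobi_defect[OF l])
  qed
  note eq = this
  obtain N where N: "\<forall>n\<ge>N. jacobi_defect p q r u v h n \<in> K" using hom[OF h(1)] by (auto simp: jacobi_def)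
  have "jacobi_defect p q r u v f n \<in> K" if "N \<le> n" for n
  proof (rule K_I)
    fix l assume l: "annihilator K l"
    show "l (jacobi_defect p q r u v f n) = 0"
      unfolding eq[OF l] by (rule annihilator_mem[OF l]) (use N that in blast)
  qed
  then show ?thesis unfolding jacobi_def by blast
qed

section \<open>Truncation, decomposition by degree and assembly of the module axioms\<close>

lemma truncation:
  assumes "fsupp f"
  shows "\<exists>N. \<forall>n\<ge>N. tact u n f \<in> K"
proof -
  obtain h where h: "h \<in> homspan" "\<forall>l. annihilator K l \<longrightarrow> l f = l h"
    using homspan_exists[OF assms] by blast
  obtain S g where S: "finite S" "\<forall>n. g n \<in> Fdeg Vg n" "h = (\<lambda>x. \<Sum>n\<in>S. g n x)"
    using homspan_decompose[OF h(1)] by blast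
  let ?D = "{k. comp Vg u k \<noteq> 0}"
  \<comment> \<open>A bound for \<open>k + d\<close> over all degrees \<open>k\<close> of components
    of \<open>u\<close> and \<open>d\<close> of \<open>h\<close>, so that all resulting degrees are
    negative.\<close>
  define N where "N = (\<Sum>k\<in>?D. \<bar>k\<bar>) + (\<Sum>n\<in>S. \<bar>n\<bar>)"
  have "tact u n f \<in> K" if "N \<le> n" for n
  proof (rule K_I)
    fix l assume l: "annihilator K l"
    have "l (tact (comp Vg u k) n (g d)) = 0" if "k \<in> ?D" "d \<in> S" for k d
    proof (rule ann_mode_neg[OF l comp_mem])
      show "g d \<in> Fdeg Vg d" using S(2) by blast
      have "\<bar>k\<bar> \<le> (\<Sum>k\<in>?D. \<bar>k\<bar>)" "\<bar>d\<bar> \<le> (\<Sum>n\<in>S. \<bar>n\<bar>)"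
        using that S(1) comp_finite[of u] by (auto intro!: member_le_sum)
      then show "k - n - 1 + d < 0" using \<open>N \<le> n\<close> by (simp add: N_def)
    qed
    then have "0 = (\<Sum>k\<in>?D. l (tact (comp Vg u k) n h))"
      by (simp add: S(3) tact_sum annihilator_sum[OF l])
    also have "\<dots> = l (tact u n h)"
      by (rule ann_letter_comp[OF l homspan_fsupp[OF h(1)], symmetric])
    also have "\<dots> = l (tact u n f)" using h(2) annihilator_tact[OF l] by metis
    finally show "l (tact u n f) = 0" by simp
  qed
  then show ?thesis by blast
qed

lemma homogeneous_decomposition:
  assumes "fsupp f"
  shows "\<exists>S g. finite S \<and> (\<forall>n\<in>S. n \<ge> 0 \<and> g n \<in> Fdeg Vg n) \<and> (\<lambda>x. f x - (\<Sum>n\<in>S. g n x)) \<in> K"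
proof -
  obtain h where h: "h \<in> homspan" "\<forall>l. annihilator K l \<longrightarrow> l f = l h"
    using homspan_exists[OF assms] by blast
  obtain S g where S: "finite S" "\<forall>n. g n \<in> Fdeg Vg n" "h = (\<lambda>x. \<Sum>n\<in>S. g n x)"
    using homspan_decompose[OF h(1)] by blast
  have "(\<lambda>x. f x - (\<Sum>n\<in>{n\<in>S. 0 \<le> n}. g n x)) \<in> K"
  proof (rule K_I)
    fix l assume l: "annihilator K l"
    have "l (g n) = 0" if "n \<in> S - {n\<in>S. 0 \<le> n}" for n
      by (rule annihilator_mem[OF l], rule K_negative_degree[of _ n]) (use S(2) that in auto)
    then have "(\<Sum>n\<in>S. l (g n)) = (\<Sum>n\<in>{n\<in>S. 0 \<le> n}. l (g n))"
      by (intro sum.mono_neutral_right S(1) ballI) blast+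
    moreover have "l f = (\<Sum>n\<in>S. l (g n))" using h(2)[rule_format, OF l] by (simp add: S(3) annihilator_sum[OF l])
    ultimately show "l (\<lambda>x. f x - (\<Sum>n\<in>{n\<in>S. 0 \<le> n}. g n x)) = 0"
      by (simp add: annihilator_diff[OF l] annihilator_sum[OF l])
  qed
  then show ?thesis using S by (intro exI[of _ "{n\<in>S. 0 \<le> n}"] exI[of _ g]) auto
qed

lemma quotient_is_module:
  "Ngradable_weak_module_mod sV Y vac Vg {f. fsupp f} K (tact :: 'v \<Rightarrow> int \<Rightarrow> (('v, 'm) word \<Rightarrow> complex) \<Rightarrow> _) (Fdeg Vg)"
  unfolding Ngradable_weak_module_mod_def
proof (intro conjI allI ballI impI)
  show "K \<subseteq> {f. fsupp f}" using K_fsupp by blast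
  show "\<exists>N. \<forall>n\<ge>N. tact u n f \<in> K" if "f \<in> {f. fsupp f}" for u f
    using truncation that by blast
  show "\<exists>N. \<forall>n\<ge>N. (\<lambda>x. (\<Sum>i\<le>n. ((of_int p) gchoose i) * tact (Y u (r + int i) v) (p + q - int i) f x)
            - (\<Sum>i\<le>n. (-1) ^ i * ((of_int r) gchoose i) *
                 (tact u (p + r - int i) (tact v (q + int i) f) x
                  - (-1) powi r * tact v (q + r - int i) (tact u (p + int i) f) x))) \<in> K"
    if "f \<in> {f. fsupp f}" for u v p q r f
    using jacobi_fsupp[of f p q r u v] that by (simp add: jacobi_def jacobi_defect_def)
  show "\<exists>S g. finite S \<and> (\<forall>n\<in>S. n \<ge> 0 \<and> g n \<in> Fdeg Vg n) \<and> (\<lambda>x. f x - (\<Sum>n\<in>S. g n x)) \<in> K"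
    if "f \<in> {f. fsupp f}" for f
    using homogeneous_decomposition that by blast
  show "g n \<in> K" if "finite S \<and> (\<forall>n\<in>S. g n \<in> Fdeg Vg n) \<and> (\<lambda>x. \<Sum>n\<in>S. g n x) \<in> K" "n \<in> S" for S g n
    using K_graded that by blast
  show "\<exists>g\<in>Fdeg Vg (j + k - n - 1). (\<lambda>x. tact u n f x - g x) \<in> K"
    if "u \<in> Vg k \<and> f \<in> Fdeg Vg j" for u k n j f
    using that Fdeg_tact[of u Vg k f j n] K_zero
    by (intro bexI[of _ "tact u n f"]) (simp_all add: algebra_simps)
  show "(\<lambda>x. tact vac n f x - (if n = -1 then f x else 0)) \<in> K" if "f \<in> {f. fsupp f}" for n f
  proof (rule K_I)
    fix l assume l: "annihilator K l"
    show "l (\<lambda>x. tact vac n f x - (if n = -1 then f x else 0)) = 0"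
      using ann_vac[OF l, of f n] that
      by (cases "n = -1") (simp_all add: annihilator_linear[OF l])
  qed
  show "(\<lambda>x. tact (sV a u + sV b u') n f x - a * tact u n f x - b * tact u' n f x) \<in> K"
    if "f \<in> {f. fsupp f}" for u u' a b n f
  proof (rule K_I)
    fix l assume l: "annihilator K l"
    show "l (\<lambda>x. tact (sV a u + sV b u') n f x - a * tact u n f x - b * tact u' n f x) = 0"
      using that by (simp add: annihilator_linear[OF l] ann_letter[OF l])
  qed
  show "(\<lambda>x. tact u n (\<lambda>y. a * f y + b * g y) x - a * tact u n f x - b * tact u n g x) \<in> K"
    for u n a b and f g :: "('v, 'm) word \<Rightarrow> complex"
    using K_zero by (simp add: tact_add tact_scale)
  show "Fdeg Vg n \<subseteq> {f. fsupp f}" for n using Fdeg_fsupp by blast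
  show "Fdeg Vg n \<subseteq> K" if "n < 0" for n using K_negative_degree that by blast
qed (simp_all add: K_zero K_add K_scale K_tact fsupp_add fsupp_scale fsupp_tact Fdeg_zero Fdeg_add Fdeg_scale)

end

theorem theorem4p1:
  fixes sV :: "complex \<Rightarrow> 'v::ab_group_add \<Rightarrow> 'v"
    and Y :: "'v \<Rightarrow> int \<Rightarrow> 'v \<Rightarrow> 'v"
    and vac :: 'v
    and Vg :: "int \<Rightarrow> 'v set"
    and L0 :: "'v \<Rightarrow> 'v"
    and sM :: "complex \<Rightarrow> 'm::ab_group_add \<Rightarrow> 'm"
    and \<rho> :: "'v \<Rightarrow> 'm \<Rightarrow> 'm"
  assumes "graded_vertex_algebra sV Y vac Vg L0"
    and "zhu_rep sV Y vac Vg sM \<rho>"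
  shows "Ngradable_weak_module_mod sV Y vac Vg {f. fsupp f} (SM_kernel sV Y Vg sM \<rho>)
           (tact :: 'v \<Rightarrow> int \<Rightarrow> (('v, 'm) word \<Rightarrow> complex) \<Rightarrow> _) (Fdeg Vg)"
proof -
  interpret zhu_setup sV Y vac Vg L0 sM \<rho> using assms by unfold_locales
  show ?thesis using quotient_is_module unfolding K_def .
qed

end
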